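(* Let $\hat{A}\in\mathbb{DC}^{n\times n}$ with $r=\operatorname{ARank}(\hat{A})$ and $t=\operatorname{Rank}(\hat{A})$. Then there exists $\hat{U}\in\mathbb{DC}_n^{U}$ such that $$\hat{A}=\hat{U}\left(\begin{bmatrix}\Sigma_1K_1&\Sigma_1L_1\\\Sigma_2M_1&\Sigma_2N_1\end{bmatrix}+\epsilon\begin{bmatrix}\Sigma_1K_2&\Sigma_1L_2\\\Sigma_2M_2&\Sigma_2N_2\end{bmatrix}\right)\hat{U}^*$$ $$=\hat{U}\left(\begin{bmatrix}\Sigma_{1s}K_1&\Sigma_{1s}L_1\\0&0\end{bmatrix}+\epsilon\begin{bmatrix}\Sigma_{1d}K_1+\Sigma_{1s}K_2&\Sigma_{1d}L_1+\Sigma_{1s}L_2\\\Sigma_{2d}M_1&\Sigma_{2d}N_1\end{bmatrix}\right)\hat{U}^*,$$ where $$\Sigma_1=\Sigma_{1s}+\epsilon\Sigma_{1d}=\operatorname{diag}(\mu_1,\ldots,\mu_r),\qquad \Sigma_2=\epsilon\Sigma_{2d}=\operatorname{diag}(\mu_{r+1},\ldots,\mu_t,0,\ldots,0)\in\mathbb{DC}^{(n-r)\times(n-r)},$$ with $\mu_1,\ldots,\mu_r$ positive appreciable dual numbers and $\mu_{r+1},\ldots,\mu_t$ positive infinitesimal dual numbers, and where $K_1,K_2\in\mathbb{C}^{r\times r}$, $L_1,L_2\in\mathbb{C}^{r\times(n-r)}$, $M_1,M_2\in\mathbb{C}^{(n-r)\times r}$, $N_1,N_2\in\mathbb{C}^{(n-r)\times(n-r)}$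 satisfy $$K_1K_1^*+L_1L_1^*=I_r,\qquad K_1K_2^*+K_2K_1^*+L_1L_2^*+L_2L_1^*=0,$$ $$M_1M_1^*+N_1N_1^*=I_{n-r},\qquad K_1M_1^*+L_1N_1^*=0.$$
   Context: Dual complex numbers are $\hat a=a_s+\epsilon a_d$ with $a_s,a_d\in\mathbb{C}$, $\epsilon\ne0$, $\epsilon^2=0$, $\epsilon$ commuting with scalars; they form the ring $\mathbb{DC}$. A dual number is such an element with $a_s,a_d\in\mathbb{R}$. It is appreciable if $a_s\neq0$ and infinitesimal if $a_s=0$. Dual numbers are totally ordered by: $\hat a\le\hat b$ iff $a_s<b_s$, or $a_s=b_s$ and $a_d\le b_d$; $\hat a$ is positive if $\hat a>0$. A matrix $\hat A\in\mathbb{DC}^{m\times n}$ is written $\hat A=A_s+\epsilon A_d$ with $A_s,A_d\in\mathbb{C}^{m\times n}$; $\hat A^*=A_s^*+\epsilon A_d^*$. $\mathbb{DC}_n^U$ is the set of $\hat U\in\mathbb{DC}^{n\times n}$ with $\hat U^{-1}=\hat U^*$. $\Sigma_{1s},\Sigma_{1d}$ are the complex (here real diagonal) standard and infinitesimal parts of $\Sigma_1$, and $\Sigma_{2d}$ is the infinitesimal part of $\Sigma_2$. Dual SVD: every $\hat A\in\mathbb{DC}^{m\times n}$ can be written $\hat A=\hat P\begin{bmatrix}\Sigma_0&0\\0&0\end{bmatrix}\hat V^*$ with $\hat P\in\mathbb{DC}_m^U$, $\hat V\in\mathbb{DC}_n^U$, $\Sigma_0=\operatorname{diag}(\mu_1,\ldots,\mu_t)$,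 $\mu_1\ge\dots\ge\mu_r$ positive appreciable and $\mu_{r+1}\ge\dots\ge\mu_t$ positive infinitesimal dual numbers, where $\Sigma_0$ is uniquely determined by $\hat A$. Then $\operatorname{Rank}(\hat A)=t$ and $\operatorname{ARank}(\hat A)=r=\operatorname{rank}(A_s)$. *)

theory Defs
  imports "Jordan_Normal_Form.Matrix" "Jordan_Normal_Form.Schur_Decomposition"
begin

text \<open>\<open>Dual a b\<close> is $a + \epsilon b$. The dual numbers are \<open>real dual\<close> and the ring of
  dual complex numbers is \<open>complex dual\<close>.\<close>

datatype 'a dual = Dual (std_part: 'a) (inf_part: 'a)

instantiation dual :: (comm_ring_1) comm_ring_1
begin

definition zero_dual :: "'a dual" where "0 = Dual 0 0"
definition one_dual :: "'a dual" where "1 = Dual 1 0"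
definition plus_dual :: "'a dual \<Rightarrow> 'a dual \<Rightarrow> 'a dual" where
  "x + y = Dual (std_part x + std_part y) (inf_part x + inf_part y)"
definition uminus_dual :: "'a dual \<Rightarrow> 'a dual" where
  "- x = Dual (- std_part x) (- inf_part x)"
definition minus_dual :: "'a dual \<Rightarrow> 'a dual \<Rightarrow> 'a dual" where
  "x - y = Dual (std_part x - std_part y) (inf_part x - inf_part y)"
definition times_dual :: "'a dual \<Rightarrow> 'a dual \<Rightarrow> 'a dual" where
  "x * y = Dual (std_part x * std_part y) (std_part x * inf_part y + inf_part x * std_part y)"

instance
  by standard (auto simp: zero_dual_def one_dual_def plus_dual_def uminus_dual_def
      minus_dual_def times_dual_def algebra_simps)

end

instantiation dual :: (linorder) linorder
begin

definition less_eq_dual :: "'a dual \<Rightarrow> 'a dual \<Rightarrow> bool" where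
  "x \<le> y \<longleftrightarrow> std_part x < std_part y \<or> std_part x = std_part y \<and> inf_part x \<le> inf_part y"
definition less_dual :: "'a dual \<Rightarrow> 'a dual \<Rightarrow> bool" where
  "(x :: 'a dual) < y \<longleftrightarrow> x \<le> y \<and> \<not> y \<le> x"

instance
  by standard (auto simp: less_eq_dual_def less_dual_def dual.expand)

end

definition appreciable :: "'a::zero dual \<Rightarrow> bool" where
  "appreciable x \<longleftrightarrow> std_part x \<noteq> 0"

definition infinitesimal :: "'a::zero dual \<Rightarrow> bool" where
  "infinitesimal x \<longleftrightarrow> std_part x = 0"

definition dual_eps :: "'a::comm_ring_1 dual" where
  "dual_eps = Dual 0 1"

definition dual_const :: "'a::comm_ring_1 \<Rightarrow> 'a dual" where
  "dual_const a = Dual a 0"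

lemma dual_eps_square: "dual_eps * dual_eps = 0"
  by (simp add: dual_eps_def times_dual_def zero_dual_def)

lemma dual_decomp: "x = dual_const (std_part x) + dual_eps * dual_const (inf_part x)"
  by (simp add: dual_eps_def dual_const_def times_dual_def plus_dual_def)

abbreviation dual_complex_of_real :: "real dual \<Rightarrow> complex dual" where
  "dual_complex_of_real \<equiv> map_dual complex_of_real"

abbreviation const_mat :: "complex mat \<Rightarrow> complex dual mat" where
  "const_mat \<equiv> map_mat dual_const"

abbreviation dual_mat :: "complex mat \<Rightarrow> complex mat \<Rightarrow> complex dual mat" where
  "dual_mat S D \<equiv> const_mat S + dual_eps \<cdot>\<^sub>m const_mat D"

text \<open>The library's \<open>mat_adjoint\<close> requires a field, so the conjugate transpose over the dual
  complex numbers is formed part by part.\<close>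

definition dual_adjoint :: "complex dual mat \<Rightarrow> complex dual mat" where
  "dual_adjoint A = dual_mat (mat_adjoint (map_mat std_part A)) (mat_adjoint (map_mat inf_part A))"

definition dual_unitary :: "nat \<Rightarrow> complex dual mat set" where
  "dual_unitary n =
     {U \<in> carrier_mat n n. inverts_mat U (dual_adjoint U) \<and> inverts_mat (dual_adjoint U) U}"

text \<open>A dual singular value decomposition with \<open>r\<close> appreciable and \<open>t - r\<close> infinitesimal
  nonzero singular values. The singular values are indexed from \<open>0\<close>, and only
  \<open>\<mu> 0, \<dots>, \<mu> (t - 1)\<close> matter.\<close>

definition is_dual_svd ::
  "complex dual mat \<Rightarrow> nat \<Rightarrow> nat \<Rightarrow> complex dual mat \<Rightarrow> (nat \<Rightarrow> real dual) \<Rightarrow> complex dual mat \<Rightarrow> bool"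
  where
  "is_dual_svd A r t P \<mu> V \<longleftrightarrow>
     (let m = dim_row A; n = dim_col A in
       r \<le> t \<and> t \<le> m \<and> t \<le> n \<and>
       P \<in> dual_unitary m \<and> V \<in> dual_unitary n \<and>
       (\<forall>i<r. appreciable (\<mu> i) \<and> 0 < \<mu> i) \<and>
       (\<forall>i. r \<le> i \<and> i < t \<longrightarrow> infinitesimal (\<mu> i) \<and> 0 < \<mu> i) \<and>
       (\<forall>i j. i \<le> j \<and> j < r \<longrightarrow> \<mu> j \<le> \<mu> i) \<and>
       (\<forall>i j. r \<le> i \<and> i \<le> j \<and> j < t \<longrightarrow> \<mu> j \<le> \<mu> i) \<and>
       A = P * four_block_mat
                 (mat_diag t (\<lambda>i. dual_complex_of_real (\<mu> i))) (0\<^sub>m t (n - t))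
                 (0\<^sub>m (m - t) t) (0\<^sub>m (m - t) (n - t))
             * dual_adjoint V)"

text \<open>Every dual complex matrix has a dual singular value decomposition, and its middle factor is
  determined by the matrix, so both descriptions below are proper.\<close>

definition dual_Rank :: "complex dual mat \<Rightarrow> nat" where
  "dual_Rank A = (THE t. \<exists>r P \<mu> V. is_dual_svd A r t P \<mu> V)"

definition dual_ARank :: "complex dual mat \<Rightarrow> nat" where
  "dual_ARank A = (THE r. \<exists>t P \<mu> V. is_dual_svd A r t P \<mu> V)"

end

theory Submission
  imports Defs "Jordan_Normal_Form.Spectral_Radius" "HOL-Combinatorics.Permutations"
begin

text \<open>If \<open>A = P S V\<^sup>*\<close> is a dual singular value decomposition, then with \<open>U = P\<close> the matrix \<open>U\<^sup>* A U\<close>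
  is \<open>S W\<close> for the dual unitary matrix \<open>W = V\<^sup>* P\<close>, and the blocks of \<open>W = W\<^sub>s + \<epsilon> W\<^sub>d\<close> are the
  \<open>K\<^sub>i\<close>, \<open>L\<^sub>i\<close>, \<open>M\<^sub>i\<close>, \<open>N\<^sub>i\<close>. For the existence of the decomposition, reduce the standard part of \<open>A\<close> to a
  real diagonal matrix \<open>S\<close> by unitary factors. Dual unitary factors \<open>1 + \<epsilon>T\<close> with \<open>T\<close>
  skew-Hermitian then bring the infinitesimal part to a matrix that commutes with \<open>S\<close> and is Hermitian
  off the kernel of \<open>S\<close>, and such a matrix has a singular value decomposition simultaneous with \<open>S\<close>.\<close>

section \<open>Complex matrices\<close>

text \<open>\<open>dual_Rank\<close> and \<open>dual_ARank\<close> are definite descriptions, so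
  \<open>r\<close> and \<open>t\<close> become accessible only once a decomposition exists and any
  two decompositions have the same counts; agreement of the two counts is enough, and the singular
  values themselves are not compared. Existence is shaped by the order on dual numbers. A value
  \<open>s + \<epsilon>h\<close> with \<open>s > 0\<close> is positive for every real
  \<open>h\<close>, so off the kernel of \<open>S\<close> the real eigenvalues of a Hermitian block,
  of either sign, can serve as infinitesimal parts. With \<open>s = 0\<close> the order demands
  \<open>h \<ge> 0\<close>, and the skew-Hermitian corrections enter only through products with
  \<open>S\<close>, so they leave the kernel block as it is; there a genuine singular value
  decomposition with different left and right factors is required. The relations among the blocks
  are block entries of the two parts of \<open>W W\<^sup>* = 1\<close>, namely
  \<open>W\<^sub>s W\<^sub>s\<^sup>* = 1\<close> and \<open>W\<^sub>s W\<^sub>d\<^sup>* + W\<^sub>d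
  W\<^sub>s\<^sup>* = 0\<close>.\<close>

lemma mult_mat_index:
  assumes "A \<in> carrier_mat m k" "B \<in> carrier_mat k n" "i < m" "j < n"
  shows "(A * B) $$ (i,j) = (\<Sum>l<k. A $$ (i,l) * B $$ (l,j))"
  using assms by (auto simp: scalar_prod_def lessThan_atLeast0 intro!: sum.cong)

lemma mat_adjoint_dim [simp]:
  "dim_row (mat_adjoint A) = dim_col A" "dim_col (mat_adjoint A) = dim_row A"
  by (auto simp: mat_adjoint_def)

lemma mat_adjoint_carrier [simp, intro]:
  "A \<in> carrier_mat m n \<Longrightarrow> mat_adjoint A \<in> carrier_mat n m"
  by (rule carrier_matI) auto

lemma mat_adjoint_index [simp]:
  fixes A :: "complex mat"
  assumes "i < dim_col A" "j < dim_row A"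
  shows "mat_adjoint A $$ (i,j) = cnj (A $$ (j,i))"
  using assms by (auto simp: mat_adjoint_def mat_of_rows_index)

lemma mat_adjoint_adjoint [simp]:
  fixes A :: "complex mat"
  shows "mat_adjoint (mat_adjoint A) = A"
  by (rule eq_matI) auto

lemma mat_adjoint_mult:
  fixes A B :: "complex mat"
  assumes "A \<in> carrier_mat m k" "B \<in> carrier_mat k n"
  shows "mat_adjoint (A * B) = mat_adjoint B * mat_adjoint A"
proof (rule eq_matI)
  fix i j assume "i < dim_row (mat_adjoint B * mat_adjoint A)"
    "j < dim_col (mat_adjoint B * mat_adjoint A)"
  then have ij: "i < n" "j < m" using assms by auto
  have "mat_adjoint (A * B) $$ (i,j) = cnj ((A * B) $$ (j,i))"
    using assms ij by (intro mat_adjoint_index) auto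
  also have "\<dots> = (\<Sum>l<k. cnj (A $$ (j,l)) * cnj (B $$ (l,i)))"
    using assms ij by (simp add: mult_mat_index[of _ m k _ n] del: index_mult_mat)
  also have "\<dots> = (\<Sum>l<k. mat_adjoint B $$ (i,l) * mat_adjoint A $$ (l,j))"
    using assms ij by (intro sum.cong) auto
  also have "\<dots> = (mat_adjoint B * mat_adjoint A) $$ (i,j)"
    by (rule mult_mat_index[symmetric, of _ n k _ m]) (use assms ij in auto)
  finally show "mat_adjoint (A * B) $$ (i,j) = (mat_adjoint B * mat_adjoint A) $$ (i,j)" .
qed (use assms in auto)

lemma mat_adjoint_one [simp]: "mat_adjoint (1\<^sub>m n :: complex mat) = 1\<^sub>m n"
  by (rule eq_matI) auto

lemma mat_adjoint_zero [simp]: "mat_adjoint (0\<^sub>m m n :: complex mat) = 0\<^sub>m n m"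
  by (rule eq_matI) auto

lemma mat_adjoint_add:
  fixes A B :: "complex mat"
  assumes "A \<in> carrier_mat m n" "B \<in> carrier_mat m n"
  shows "mat_adjoint (A + B) = mat_adjoint A + mat_adjoint B"
  by (rule eq_matI) (use assms in auto)

section \<open>Unitary matrices and completion of orthonormal columns\<close>

text \<open>The identity demanded is exactly orthonormality of the columns, which is what the
  constructions below produce; for square matrices the other identity follows.\<close>

definition cunitary :: "nat \<Rightarrow> complex mat set" where
  "cunitary n = {P \<in> carrier_mat n n. mat_adjoint P * P = 1\<^sub>m n}"

lemma cunitaryD:
  assumes "P \<in> cunitary n"
  shows "P \<in> carrier_mat n n" "mat_adjoint P * P = 1\<^sub>m n" "P * mat_adjoint P = 1\<^sub>m n"
proof -
  show P: "P \<in> carrier_mat n n" "mat_adjoint P * P = 1\<^sub>m n"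
    using assms by (auto simp: cunitary_def)
  show "P * mat_adjoint P = 1\<^sub>m n"
    by (rule mat_mult_left_right_inverse[OF _ _ P(2)]) (use P in auto)
qed

text \<open>Padding the underdetermined system with zero rows makes it square with determinant zero.\<close>

lemma underdetermined_system:
  fixes c :: "nat \<Rightarrow> nat \<Rightarrow> 'a :: field"
  assumes "finite J" "card J < n"
  shows "\<exists>x \<in> carrier_vec n. x \<noteq> 0\<^sub>v n \<and> (\<forall>i\<in>J. (\<Sum>k<n. c i k * x $ k) = 0)"
proof -
  obtain e where e: "bij_betw e {..<card J} J"
    using assms(1) ex_bij_betw_nat_finite lessThan_atLeast0 by metis
  define M where "M = mat n n (\<lambda>(i,k). if i < card J then c (e i) k else 0)"
  have M: "M \<in> carrier_mat n n" by (simp add: M_def)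
  have "M\<^sup>T *\<^sub>v unit_vec n (card J) = 0\<^sub>v n"
    using assms(2) by (intro eq_vecI) (auto simp: M_def)
  moreover have "unit_vec n (card J) \<noteq> (0\<^sub>v n :: 'a vec)"
    using assms(2) by (metis index_unit_vec(2) index_zero_vec(1) zero_neq_one)
  ultimately have "det (M\<^sup>T) = 0"
    using det_0_iff_vec_prod_zero_field[of "M\<^sup>T" n] M unit_vec_carrier transpose_carrier_mat
    by blast
  then have "det M = 0" using M by (simp add: det_transpose)
  then obtain x where x: "x \<in> carrier_vec n" "x \<noteq> 0\<^sub>v n" "M *\<^sub>v x = 0\<^sub>v n"
    using det_0_iff_vec_prod_zero_field[OF M] by auto
  have "(\<Sum>k<n. c i k * x $ k) = 0" if "i \<in> J" for i
  proof -
    obtain l where l: "l < card J" "i = e l"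
      using \<open>i \<in> J\<close> e by (auto simp: bij_betw_def)
    have "(M *\<^sub>v x) $ l = (\<Sum>k<n. c i k * x $ k)"
      using l assms(2) x(1)
      by (auto simp: M_def scalar_prod_def lessThan_atLeast0 intro!: sum.cong)
    then show ?thesis using x(3) l assms(2) by simp
  qed
  then show ?thesis using x by blast
qed

lemma sum_cnj_mult_self: "(\<Sum>k<n. cnj (f k) * f k) = complex_of_real (\<Sum>k<n. (cmod (f k))\<^sup>2)"
  by (simp add: complex_norm_square mult.commute del: of_real_power)

lemma normalize_vec:
  fixes x :: "complex vec"
  assumes "x \<in> carrier_vec n" "x \<noteq> 0\<^sub>v n"
  shows "\<exists>c. c \<noteq> 0 \<and> (\<Sum>k<n. cnj (c * x $ k) * (c * x $ k)) = 1"
proof -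
  define s where "s = (\<Sum>k<n. (cmod (x $ k))\<^sup>2)"
  obtain k where "k < n" "x $ k \<noteq> 0" using assms by (metis eq_vecI carrier_vecD index_zero_vec)
  then have "s > 0" unfolding s_def by (intro sum_pos2[of _ k]) auto
  then have "(\<Sum>k<n. cnj (of_real (1 / sqrt s) * x $ k) * (of_real (1 / sqrt s) * x $ k)) = 1"
    unfolding sum_cnj_mult_self
    by (simp add: norm_mult norm_divide power_mult_distrib power_divide flip: sum_divide_distrib s_def)
  then show ?thesis using \<open>s > 0\<close> by (intro exI[of _ "of_real (1 / sqrt s)"]) auto
qed

text \<open>As long as a position is free, fewer than \<open>n\<close> columns are prescribed, so
  some unit vector is orthogonal to all of them and can fill it. \<open>J\<close> is an arbitrary
  set of positions because the singular vectors that get prescribed later need not occupy an initial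
  segment.\<close>

lemma extend_orthonormal_columns:
  assumes "J \<subseteq> {..<n}"
    and "\<And>i j. i \<in> J \<Longrightarrow> j \<in> J \<Longrightarrow> (\<Sum>k<n. cnj (U k i) * U k j) = (if i = j then 1 else 0)"
  shows "\<exists>P \<in> cunitary n. \<forall>j\<in>J. \<forall>k<n. P $$ (k,j) = U k j"
  using assms
proof (induction "card ({..<n} - J)" arbitrary: J U)
  case 0
  then have J: "J = {..<n}" by auto
  define P where "P = mat n n (\<lambda>(k,j). U k j)"
  have P: "P \<in> carrier_mat n n" by (simp add: P_def)
  have "mat_adjoint P * P = 1\<^sub>m n"
  proof (rule eq_matI)
    fix i j assume "i < dim_row (1\<^sub>m n :: complex mat)" "j < dim_col (1\<^sub>m n :: complex mat)"
    then have ij: "i < n" "j < n" by auto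
    have "(mat_adjoint P * P) $$ (i,j) = (\<Sum>k<n. mat_adjoint P $$ (i,k) * P $$ (k,j))"
      by (rule mult_mat_index[of _ n n _ n]) (use P ij in auto)
    also have "\<dots> = (\<Sum>k<n. cnj (U k i) * U k j)"
      using ij by (intro sum.cong) (auto simp: P_def)
    finally show "(mat_adjoint P * P) $$ (i,j) = 1\<^sub>m n $$ (i,j)"
      using 0(3)[of i j] ij J by simp
  qed (use P in auto)
  then have "P \<in> cunitary n" using P by (simp add: cunitary_def)
  then show ?case using J by (intro bexI[of _ P]) (auto simp: P_def)
next
  case (Suc d)
  have fin: "finite J" using Suc.prems(1) finite_subset by blast
  obtain m where m: "m < n" "m \<notin> J"
    using Suc.hyps(2) by (metis Diff_iff card.empty empty_iff equals0I lessThan_iff nat.distinct(1))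
  have "card J < n" 
    using Suc.prems(1) m psubset_card_mono[of "{..<n}" J] by auto
  \<comment> \<open>The coefficients are conjugated columns, so that solving the system means being
    orthogonal to the columns already chosen.\<close>
  from underdetermined_system[OF fin this, of "\<lambda>i k. cnj (U k i)"]
  obtain x where x: "x \<in> carrier_vec n" "x \<noteq> 0\<^sub>v n" "\<forall>i\<in>J. (\<Sum>k<n. cnj (U k i) * x $ k) = 0"
    by blast
  obtain c where c: "(\<Sum>k<n. cnj (c * x $ k) * (c * x $ k)) = 1"
    using normalize_vec[OF x(1,2)] by blast
  define U' where "U' = (\<lambda>k j. if j = m then c * x $ k else U k j)"
  have orth: "(\<Sum>k<n. cnj (U k i) * (c * x $ k)) = 0" if "i \<in> J" for i
    using x(3) that by (simp add: mult.left_commute flip: sum_distrib_left)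
  have orth': "(\<Sum>k<n. cnj (c * x $ k) * U k i) = 0" if "i \<in> J" for i
  proof -
    have "(\<Sum>k<n. cnj (c * x $ k) * U k i) = cnj (\<Sum>k<n. cnj (U k i) * (c * x $ k))"
      by (simp add: mult.commute)
    then show ?thesis using orth[OF that] by simp
  qed
  have "\<exists>P \<in> cunitary n. \<forall>j\<in>insert m J. \<forall>k<n. P $$ (k,j) = U' k j"
  proof (rule Suc.hyps(1))
    show "d = card ({..<n} - insert m J)"
      using Suc.hyps(2) m by (metis Diff_insert card_Diff_singleton diff_Suc_1 Diff_iff lessThan_iff)
    show "insert m J \<subseteq> {..<n}" using Suc.prems(1) m by auto
    show "(\<Sum>k<n. cnj (U' k i) * U' k j) = (if i = j then 1 else 0)"
      if ij: "i \<in> insert m J" "j \<in> insert m J" for i j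
    proof -
      have U'm: "U' k m = c * x $ k" for k by (simp add: U'_def)
      have U'J: "U' k i = U k i" if "i \<in> J" for i k using that m by (auto simp: U'_def)
      consider "i = m" "j = m" | "i = m" "j \<in> J" | "i \<in> J" "j = m" | "i \<in> J" "j \<in> J"
        using ij by auto
      then show ?thesis
      proof cases
        case 1 then show ?thesis unfolding 1 U'm using c by simp
      next
        case 2 then show ?thesis unfolding U'J[OF 2(2)] 2(1) U'm using orth' m by auto
      next
        case 3 then show ?thesis unfolding U'J[OF 3(1)] 3(2) U'm using orth m by auto
      next
        case 4 then show ?thesis unfolding U'J[OF 4(1)] U'J[OF 4(2)] using Suc.prems(2) by simp
      qed
    qed
  qed
  then obtain P where P: "P \<in> cunitary n" "\<forall>j\<in>insert m J. \<forall>k<n. P $$ (k,j) = U' k j" by blast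
  moreover have "U' k j = U k j" if "j \<in> J" for k j using that m(2) by (auto simp: U'_def)
  ultimately show ?case by (intro bexI[of _ P]) auto
qed

section \<open>Normal matrices, commuting Hermitian matrices and simultaneous singular
  values\<close>

lemma mult_mat_vec_index:
  assumes "A \<in> carrier_mat m n" "v \<in> carrier_vec n" "i < m"
  shows "(A *\<^sub>v v) $ i = (\<Sum>l<n. A $$ (i,l) * v $ l)"
  using assms by (auto simp: scalar_prod_def lessThan_atLeast0 intro!: sum.cong)

lemma cunitary_columns:
  assumes "P \<in> cunitary n" "i < n" "j < n"
  shows "(\<Sum>k<n. cnj (P $$ (k,i)) * P $$ (k,j)) = (if i = j then 1 else 0)"
proof -
  note P = cunitaryD[OF assms(1)]
  have "(mat_adjoint P * P) $$ (i,j) = (\<Sum>k<n. mat_adjoint P $$ (i,k) * P $$ (k,j))"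
    by (rule mult_mat_index[of _ n n _ n]) (use P assms in auto)
  also have "\<dots> = (\<Sum>k<n. cnj (P $$ (k,i)) * P $$ (k,j))"
    using P(1) assms by (intro sum.cong) auto
  finally show ?thesis using P(2) assms by simp
qed

lemma adjoint_scalar_prod:
  fixes M :: "complex mat"
  assumes "M \<in> carrier_mat m n" "x \<in> carrier_vec n" "y \<in> carrier_vec m"
  shows "(M *\<^sub>v x) \<bullet>c y = x \<bullet>c (mat_adjoint M *\<^sub>v y)"
proof -
  have "(M *\<^sub>v x) \<bullet>c y = (\<Sum>i<m. (\<Sum>k<n. M $$ (i,k) * x $ k) * cnj (y $ i))"
    using assms
    by (auto simp: scalar_prod_def lessThan_atLeast0 intro!: sum.cong)
  also have "\<dots> = (\<Sum>k<n. x $ k * (\<Sum>i<m. M $$ (i,k) * cnj (y $ i)))"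
    unfolding sum_distrib_left sum_distrib_right
    by (subst sum.swap) (simp add: ac_simps)
  also have "\<dots> = x \<bullet>c (mat_adjoint M *\<^sub>v y)"
    using assms
    by (auto simp: scalar_prod_def lessThan_atLeast0 intro!: sum.cong)
  finally show ?thesis .
qed

lemma scalar_prod_conj_swap:
  fixes x y :: "complex vec"
  assumes "x \<in> carrier_vec n" "y \<in> carrier_vec n"
  shows "y \<bullet>c x = cnj (x \<bullet>c y)"
  using assms by (auto simp: scalar_prod_def mult.commute)

lemma norm_diff_smult:
  fixes v w :: "complex vec"
  assumes "w \<in> carrier_vec n" "v \<in> carrier_vec n"
  shows "(w - cnj l \<cdot>\<^sub>v v) \<bullet>c (w - cnj l \<cdot>\<^sub>v v)
      = w \<bullet>c w - l * (w \<bullet>c v) - cnj l * (v \<bullet>c w) + cnj l * l * (v \<bullet>c v)"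
  using assms
  by (simp add: scalar_prod_def algebra_simps sum.distrib sum_subtractf sum_distrib_left)

text \<open>Normality gives \<open>M\<close> and its adjoint the same norm on \<open>v\<close>;
  expanding the squared norm of \<open>mat_adjoint M *\<^sub>v v - cnj l \<cdot>\<^sub>v v\<close>
  then leaves four terms that are all multiples of \<open>l * cnj l * (v \<bullet>c v)\<close> and
  cancel.\<close>

lemma normal_adjoint_eigenvector:
  fixes M :: "complex mat"
  assumes M: "M \<in> carrier_mat n n" "M * mat_adjoint M = mat_adjoint M * M"
    and v: "v \<in> carrier_vec n" "M *\<^sub>v v = l \<cdot>\<^sub>v v"
  shows "mat_adjoint M *\<^sub>v v = cnj l \<cdot>\<^sub>v v"
proof -
  let ?w = "mat_adjoint M *\<^sub>v v"
  have w: "?w \<in> carrier_vec n" by (rule mult_mat_vec_carrier[of _ n n]) (use M v in auto)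
  have ww: "?w \<bullet>c ?w = l * cnj l * (v \<bullet>c v)"
  proof -
    have "?w \<bullet>c ?w = v \<bullet>c (M *\<^sub>v ?w)"
      using adjoint_scalar_prod[of "mat_adjoint M" n n v ?w] M(1) v w by auto
    also have "M *\<^sub>v ?w = (M * mat_adjoint M) *\<^sub>v v"
      using M v by (intro assoc_mult_mat_vec[symmetric, of _ n n _ n]) auto
    also have "\<dots> = mat_adjoint M *\<^sub>v (M *\<^sub>v v)"
      unfolding M(2) using M v by (intro assoc_mult_mat_vec[of _ n n _ n]) auto
    also have "v \<bullet>c \<dots> = (M *\<^sub>v v) \<bullet>c (M *\<^sub>v v)"
      using adjoint_scalar_prod[of M n n v "M *\<^sub>v v"] M(1) v(1) by auto
    finally show ?thesis unfolding v(2)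
      using v(1) by (simp add: conjugate_smult_vec)
  qed
  have vw: "v \<bullet>c ?w = l * (v \<bullet>c v)"
    using adjoint_scalar_prod[OF M(1) v(1) v(1)] v by simp
  have wv: "?w \<bullet>c v = cnj l * (v \<bullet>c v)"
    using scalar_prod_conj_swap[OF v(1) w] vw scalar_prod_conj_swap[OF v(1) v(1)] by simp
  have "(?w - cnj l \<cdot>\<^sub>v v) \<bullet>c (?w - cnj l \<cdot>\<^sub>v v)
      = ?w \<bullet>c ?w - l * (?w \<bullet>c v) - cnj l * (v \<bullet>c ?w) + cnj l * l * (v \<bullet>c v)"
    by (rule norm_diff_smult[OF w v(1)])
  then have "(?w - cnj l \<cdot>\<^sub>v v) \<bullet>c (?w - cnj l \<cdot>\<^sub>v v) = 0"
    unfolding ww vw wv by (simp add: algebra_simps)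
  then have z: "?w - cnj l \<cdot>\<^sub>v v = 0\<^sub>v n"
    using conjugate_square_eq_0_vec[of "?w - cnj l \<cdot>\<^sub>v v" n] v(1) w by auto
  show ?thesis
  proof (rule eq_vecI)
    fix i assume "i < dim_vec (cnj l \<cdot>\<^sub>v v)"
    then have "i < n" using v(1) by simp
    then have "(?w - cnj l \<cdot>\<^sub>v v) $ i = 0" using z by simp
    then show "?w $ i = (cnj l \<cdot>\<^sub>v v) $ i" using \<open>i < n\<close> v w M by simp
  qed (use M(1) v(1) in auto)
qed

text \<open>Eigenvectors of a normal matrix are also eigenvectors of its adjoint, so their
  orthogonal complement is invariant and contains a further eigenvector. Only the first
  \<open>k\<close> columns are constrained, which leaves the others free to be replaced in the next
  step.\<close>

lemma normal_partial_diagonalization: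
  fixes M :: "complex mat"
  assumes M: "M \<in> carrier_mat n n" "M * mat_adjoint M = mat_adjoint M * M"
    and "k \<le> n"
  shows "\<exists>P \<in> cunitary n. \<exists>l. \<forall>j<k. M *\<^sub>v col P j = l j \<cdot>\<^sub>v col P j"
  using assms(3)
proof (induction k)
  case 0
  have "1\<^sub>m n \<in> cunitary n" by (simp add: cunitary_def)
  then show ?case by auto
next
  case (Suc k)
  then obtain P l where P: "P \<in> cunitary n"
    and l: "\<And>j. j < k \<Longrightarrow> M *\<^sub>v col P j = l j \<cdot>\<^sub>v col P j" by auto
  note Pc = cunitaryD[OF P]
  have colP: "col P j \<in> carrier_vec n" for j using Pc(1) by auto
  define N where "N = mat_adjoint P * (M * P)"
  have Nc: "N \<in> carrier_mat n n" using Pc(1) M(1) by (auto simp: N_def)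
  \<comment> \<open>Invariance of the orthogonal complement in coordinates: moving \<open>M\<close>
    across the scalar product turns it into its adjoint, which only scales
    \<open>col P j\<close>.\<close>
  have N0: "N $$ (j,i) = 0" if "j < k" "k \<le> i" "i < n" for i j
  proof -
    have j: "j < n" using that by simp
    have "N $$ (j,i) = row (mat_adjoint P) j \<bullet> col (M * P) i"
      unfolding N_def using that Pc(1) M(1) by auto
    also have "row (mat_adjoint P) j = conjugate (col P j)"
      using j Pc(1) by (intro eq_vecI) auto
    also have "col (M * P) i = M *\<^sub>v col P i"
      using that Pc(1) M(1) by (intro col_mult2[of _ n n _ n]) auto
    also have "conjugate (col P j) \<bullet> (M *\<^sub>v col P i) = (M *\<^sub>v col P i) \<bullet>c col P j"
      using Pc(1) M(1) by (intro comm_scalar_prod[of _ n]) auto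
    also have "\<dots> = col P i \<bullet>c (cnj (l j) \<cdot>\<^sub>v col P j)"
      using adjoint_scalar_prod[OF M(1) colP colP]
        normal_adjoint_eigenvector[OF M colP l[OF that(1)]] by simp
    also have "\<dots> = l j * (\<Sum>k<n. cnj (P $$ (k,j)) * P $$ (k,i))"
      using Pc(1) that
      by (auto simp: scalar_prod_def lessThan_atLeast0 sum_distrib_left intro!: sum.cong)
    also have "\<dots> = 0" using cunitary_columns[OF P j that(3)] that by simp
    finally show ?thesis .
  qed
  \<comment> \<open>The compression of \<open>M\<close> to the complement of the first
    \<open>k\<close> columns. Its size \<open>n - k\<close> is positive, so it has a complex
    eigenvalue.\<close>
  define N' where "N' = mat (n - k) (n - k) (\<lambda>(i,j). N $$ (i + k, j + k))"
  have "N' \<in> carrier_mat (n - k) (n - k)" by (simp add: N'_def)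
  from spectrum_non_empty[OF this] Suc.prems obtain c where "eigenvalue N' c"
    by (auto simp: spectrum_def)
  then obtain w where w: "w \<in> carrier_vec (n - k)" "w \<noteq> 0\<^sub>v (n - k)" "N' *\<^sub>v w = c \<cdot>\<^sub>v w"
    unfolding eigenvalue_def eigenvector_def by (auto simp: N'_def)
  \<comment> \<open>The \<open>k\<close> leading zeros make this an eigenvector of the whole of
    \<open>N\<close>: by \<open>N0\<close> the upper right block contributes nothing.\<close>
  define x where "x = vec n (\<lambda>i. if i < k then 0 else w $ (i - k))"
  have x: "x \<in> carrier_vec n" by (simp add: x_def)
  have Nx: "N *\<^sub>v x = c \<cdot>\<^sub>v x"
  proof (rule eq_vecI)
    fix j assume "j < dim_vec (c \<cdot>\<^sub>v x)"
    then have j: "j < n" using x by simp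
    have "(N *\<^sub>v x) $ j = (\<Sum>i<n. N $$ (j,i) * x $ i)"
      by (rule mult_mat_vec_index[OF Nc x j])
    also have "\<dots> = (\<Sum>i\<in>{k..<n}. N $$ (j,i) * w $ (i - k))"
      by (rule sum.mono_neutral_cong_right) (auto simp: x_def)
    also have "\<dots> = (c \<cdot>\<^sub>v x) $ j"
    proof (cases "j < k")
      case True
      then show ?thesis using N0 j by (simp add: x_def)
    next
      case False
      have "(\<Sum>i\<in>{k..<n}. N $$ (j,i) * w $ (i - k)) = (\<Sum>i<n - k. N $$ (j,i + k) * w $ i)"
        by (rule sum.reindex_bij_witness[of _ "\<lambda>i. i + k" "\<lambda>i. i - k"]) auto
      also have "\<dots> = (\<Sum>i<n - k. N' $$ (j - k,i) * w $ i)"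
        using False j by (intro sum.cong) (auto simp: N'_def)
      also have "\<dots> = (N' *\<^sub>v w) $ (j - k)"
        by (rule mult_mat_vec_index[symmetric, of _ "n - k"]) (use False j w in \<open>auto simp: N'_def\<close>)
      also have "\<dots> = (c \<cdot>\<^sub>v x) $ j"
        unfolding w(3) using False j w(1) by (simp add: x_def)
      finally show ?thesis .
    qed
    finally show "(N *\<^sub>v x) $ j = (c \<cdot>\<^sub>v x) $ j" .
  qed (use Nc x in auto)
  define y where "y = P *\<^sub>v x"
  have y: "y \<in> carrier_vec n" using Pc(1) x by (auto simp: y_def)
  have Py: "mat_adjoint P *\<^sub>v y = x"
    unfolding y_def using Pc x by (simp add: assoc_mult_mat_vec[of _ n n _ n, symmetric])
  have My: "M *\<^sub>v y = c \<cdot>\<^sub>v y"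
  proof -
    have "M *\<^sub>v y = (P * mat_adjoint P) *\<^sub>v (M *\<^sub>v y)"
      using Pc M y by simp
    also have "\<dots> = P *\<^sub>v (N *\<^sub>v x)"
      unfolding y_def N_def using Pc(1) M(1) x
      by (simp add: assoc_mult_mat_vec[of _ n n _ n])
    finally show ?thesis unfolding Nx y_def using Pc x by (simp add: mult_mat_vec[of _ n n])
  qed
  obtain i where i: "i < n - k" "w $ i \<noteq> 0"
    using w(1,2) by (metis eq_vecI carrier_vecD index_zero_vec)
  then have "x $ (i + k) \<noteq> 0" "i + k < n" by (auto simp: x_def)
  then have "x \<noteq> 0\<^sub>v n" by auto
  then have "y \<noteq> 0\<^sub>v n" using Py Pc(1) by auto
  from normalize_vec[OF y this] obtain a
    where a: "(\<Sum>k<n. cnj (a * y $ k) * (a * y $ k)) = 1" by blast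
  \<comment> \<open>In the basis of the columns of \<open>P\<close> the vector \<open>y\<close> has
    the coordinates \<open>x\<close>, whose first \<open>k\<close> entries are zero.\<close>
  have orth: "(\<Sum>i<n. cnj (P $$ (i,j)) * y $ i) = 0" if "j < k" for j
  proof -
    have j: "j < n" using that Suc.prems by simp
    have "(\<Sum>i<n. cnj (P $$ (i,j)) * y $ i) = (\<Sum>i<n. mat_adjoint P $$ (j,i) * y $ i)"
      using j Pc(1) by (intro sum.cong) auto
    also have "\<dots> = (mat_adjoint P *\<^sub>v y) $ j"
      by (rule mult_mat_vec_index[symmetric, of _ n]) (use Pc(1) y j in auto)
    finally show ?thesis using Py that j by (simp add: x_def)
  qed
  \<comment> \<open>Columns of \<open>P\<close> after position \<open>k\<close> are given up, since
    they need not be orthogonal to \<open>y\<close>; the completion supplies new ones.\<close>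
  define U where "U = (\<lambda>i j. if j = k then a * y $ i else P $$ (i,j))"
  have orth1: "(\<Sum>i<n. cnj (P $$ (i,j)) * (a * y $ i)) = 0" if "j < k" for j
    using orth[OF that] by (simp add: mult.left_commute flip: sum_distrib_left)
  have orth2: "(\<Sum>i<n. cnj (a * y $ i) * P $$ (i,j)) = 0" if "j < k" for j
  proof -
    have "(\<Sum>i<n. cnj (a * y $ i) * P $$ (i,j)) = cnj (\<Sum>i<n. cnj (P $$ (i,j)) * (a * y $ i))"
      by (simp add: mult.commute)
    then show ?thesis using orth1[OF that] by simp
  qed
  have orthonormal: "(\<Sum>m<n. cnj (U m i) * U m j) = (if i = j then 1 else 0)"
    if "i \<in> {..k}" "j \<in> {..k}" for i j
    using that a orth1[of i] orth2[of j] cunitary_columns[OF P, of i j] Suc.prems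
    by (cases "i = k"; cases "j = k") (simp_all add: U_def)
  have "{..k} \<subseteq> {..<n}" using Suc.prems by auto
  from extend_orthonormal_columns[OF this orthonormal]
  obtain Q where Q: "Q \<in> cunitary n" "\<forall>j\<in>{..k}. \<forall>i<n. Q $$ (i,j) = U i j" by blast
  have colQ: "col Q j = col P j" if "j < k" for j
    using that Q(2) cunitaryD(1)[OF Q(1)] Pc(1) Suc.prems by (intro eq_vecI) (auto simp: U_def)
  have colQk: "col Q k = a \<cdot>\<^sub>v y"
    using Q(2) cunitaryD(1)[OF Q(1)] y Suc.prems by (intro eq_vecI) (auto simp: U_def)
  have "M *\<^sub>v col Q k = c \<cdot>\<^sub>v col Q k"
    unfolding colQk using M(1) y My
    by (simp add: mult_mat_vec[of _ n n] smult_smult_assoc mult.commute)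
  then have "\<forall>j<Suc k. M *\<^sub>v col Q j = (l(k := c)) j \<cdot>\<^sub>v col Q j"
    using l colQ by (auto simp: less_Suc_eq)
  then show ?case using Q(1) by blast
qed

text \<open>A pair of commuting Hermitian matrices \<open>S\<close>, \<open>G\<close> is diagonalized by diagonalizing the normal
  matrix \<open>S + iG\<close>.\<close>

lemma commuting_hermitian_diagonalization:
  fixes S G :: "complex mat"
  assumes S: "S \<in> carrier_mat n n" "mat_adjoint S = S"
    and G: "G \<in> carrier_mat n n" "mat_adjoint G = G"
    and SG: "S * G = G * S"
  shows "\<exists>V \<in> cunitary n. \<exists>s g. \<forall>j<n. S *\<^sub>v col V j = complex_of_real (s j) \<cdot>\<^sub>v col V j
    \<and> G *\<^sub>v col V j = complex_of_real (g j) \<cdot>\<^sub>v col V j"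
proof -
  define M where "M = S + \<i> \<cdot>\<^sub>m G"
  have M: "M \<in> carrier_mat n n" using S G by (simp add: M_def)
  have SG': "S $$ (j,i) = cnj (S $$ (i,j))" "G $$ (j,i) = cnj (G $$ (i,j))" if "i < n" "j < n" for i j
    using that S G by (metis carrier_matD mat_adjoint_index)+
  have adM: "mat_adjoint M = S - \<i> \<cdot>\<^sub>m G"
  proof (rule eq_matI)
    fix i j assume "i < dim_row (S - \<i> \<cdot>\<^sub>m G)" "j < dim_col (S - \<i> \<cdot>\<^sub>m G)"
    then have ij: "i < n" "j < n" using S G by auto
    then have "mat_adjoint M $$ (i,j) = cnj (S $$ (j,i)) - \<i> * cnj (G $$ (j,i))"
      using S(1) G(1) M by (subst mat_adjoint_index) (auto simp: M_def)
    then show "mat_adjoint M $$ (i,j) = (S - \<i> \<cdot>\<^sub>m G) $$ (i,j)"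
      using ij S(1) G(1) by (simp add: SG'(1)[OF ij(2,1)] SG'(2)[OF ij(2,1)])
  qed (use S(1) G(1) M in auto)
  \<comment> \<open>Both products are \<open>S\<^sup>2 + G\<^sup>2\<close> plus or minus
    \<open>\<i> (G S - S G)\<close>, and the commutator is zero.\<close>
  have "M * mat_adjoint M = mat_adjoint M * M"
  proof (rule eq_matI)
    fix i j assume "i < dim_row (mat_adjoint M * M)" "j < dim_col (mat_adjoint M * M)"
    then have ij: "i < n" "j < n" using M by auto
    have M': "S - \<i> \<cdot>\<^sub>m G \<in> carrier_mat n n" using S G by auto
    have "(\<Sum>l<n. S $$ (i,l) * G $$ (l,j)) = (\<Sum>l<n. G $$ (i,l) * S $$ (l,j))"
      using arg_cong[OF SG, of "\<lambda>X. X $$ (i,j)"] mult_mat_index[OF S(1) G(1) ij]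
        mult_mat_index[OF G(1) S(1) ij] by simp
    moreover have "(M * (S - \<i> \<cdot>\<^sub>m G)) $$ (i,j)
      = (\<Sum>l<n. S $$ (i,l) * S $$ (l,j)) + (\<Sum>l<n. G $$ (i,l) * G $$ (l,j))
        + \<i> * ((\<Sum>l<n. G $$ (i,l) * S $$ (l,j)) - (\<Sum>l<n. S $$ (i,l) * G $$ (l,j)))"
      unfolding mult_mat_index[OF M M' ij] using ij S(1) G(1)
      by (simp add: M_def algebra_simps sum.distrib sum_subtractf sum_distrib_left)
    moreover have "((S - \<i> \<cdot>\<^sub>m G) * M) $$ (i,j)
      = (\<Sum>l<n. S $$ (i,l) * S $$ (l,j)) + (\<Sum>l<n. G $$ (i,l) * G $$ (l,j))
        + \<i> * ((\<Sum>l<n. S $$ (i,l) * G $$ (l,j)) - (\<Sum>l<n. G $$ (i,l) * S $$ (l,j)))"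
      unfolding mult_mat_index[OF M' M ij] using ij S(1) G(1)
      by (simp add: M_def algebra_simps sum.distrib sum_subtractf sum_distrib_left)
    ultimately show "(M * mat_adjoint M) $$ (i,j) = (mat_adjoint M * M) $$ (i,j)"
      unfolding adM by simp
  qed (use M in auto)
  note nor = this
  from normal_partial_diagonalization[OF M this order_refl] obtain V l where V: "V \<in> cunitary n"
    and l: "\<And>j. j < n \<Longrightarrow> M *\<^sub>v col V j = l j \<cdot>\<^sub>v col V j" by blast
  note Vc = cunitaryD[OF V]
  have "S *\<^sub>v col V j = complex_of_real (Re (l j)) \<cdot>\<^sub>v col V j
    \<and> G *\<^sub>v col V j = complex_of_real (Im (l j)) \<cdot>\<^sub>v col V j" if "j < n" for j
  proof -
    define v where "v = col V j"
    have v: "v \<in> carrier_vec n" using Vc(1) by (auto simp: v_def)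
    \<comment> \<open>Half the sum of the two equations isolates \<open>S\<close> and half the
      difference isolates \<open>\<i> G\<close>, hence the real and imaginary parts of
      \<open>l j\<close> as eigenvalues.\<close>
    have e: "M *\<^sub>v v = l j \<cdot>\<^sub>v v" "mat_adjoint M *\<^sub>v v = cnj (l j) \<cdot>\<^sub>v v"
      using l[OF that] normal_adjoint_eigenvector[OF M nor v, of "l j"] by (auto simp: v_def)
    have "(S *\<^sub>v v) $ i = Re (l j) * v $ i \<and> (G *\<^sub>v v) $ i = Im (l j) * v $ i" if i: "i < n" for i
    proof -
      have "(M *\<^sub>v v) $ i = (S *\<^sub>v v) $ i + \<i> * (G *\<^sub>v v) $ i"
        unfolding mult_mat_vec_index[OF M v i] mult_mat_vec_index[OF S(1) v i]
          mult_mat_vec_index[OF G(1) v i]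
        using i S(1) G(1) by (simp add: M_def algebra_simps sum.distrib sum_distrib_left)
      then have 1: "(S *\<^sub>v v) $ i + \<i> * (G *\<^sub>v v) $ i = l j * v $ i"
        using v i unfolding e by simp
      have "(mat_adjoint M *\<^sub>v v) $ i = (S *\<^sub>v v) $ i - \<i> * (G *\<^sub>v v) $ i"
        unfolding mult_mat_vec_index[OF mat_adjoint_carrier[OF M] v i]
          mult_mat_vec_index[OF S(1) v i] mult_mat_vec_index[OF G(1) v i]
        using i S(1) G(1) by (simp add: adM algebra_simps sum_subtractf sum_distrib_left)
      then have 2: "(S *\<^sub>v v) $ i - \<i> * (G *\<^sub>v v) $ i = cnj (l j) * v $ i"
        using v i unfolding e by simp
      have "2 * (S *\<^sub>v v) $ i = (l j + cnj (l j)) * v $ i"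
        using 1 2 by (simp add: algebra_simps)
      moreover have "2 * \<i> * (G *\<^sub>v v) $ i = (l j - cnj (l j)) * v $ i"
        using 1 2 by (simp add: algebra_simps)
      ultimately show ?thesis
        by (simp add: complex_add_cnj complex_diff_cnj)
    qed
    then show ?thesis unfolding v_def[symmetric] using v S G by (auto intro!: eq_vecI)
  qed
  then show ?thesis using V by (intro bexI[of _ V] exI) auto
qed

text \<open>The hypotheses say that \<open>B\<close> commutes with the diagonal matrix \<open>S\<close> of the \<open>\<sigma> i\<close> and that
  \<open>B\<close> is Hermitian off the kernel of \<open>S\<close>. The right singular vectors are common eigenvectors of
  \<open>S\<close> and of the Hermitian matrix that equals \<open>B\<close> off the kernel of \<open>S\<close> and \<open>B\<^sup>*B\<close> on it.
  For \<open>\<sigma> = 0\<close> this is the singular value decomposition of \<open>B\<close>.\<close>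

lemma simultaneous_svd:
  fixes \<sigma> :: "nat \<Rightarrow> real" and B :: "complex mat"
  assumes B: "B \<in> carrier_mat n n"
    and nonneg: "\<And>i. i < n \<Longrightarrow> 0 \<le> \<sigma> i"
    and comm: "\<And>i j. i < n \<Longrightarrow> j < n \<Longrightarrow> \<sigma> i \<noteq> \<sigma> j \<Longrightarrow> B $$ (i,j) = 0"
    and herm: "\<And>i j. i < n \<Longrightarrow> j < n \<Longrightarrow> \<sigma> i = \<sigma> j \<Longrightarrow> \<sigma> i \<noteq> 0 \<Longrightarrow> B $$ (j,i) = cnj (B $$ (i,j))"
  shows "\<exists>P \<in> cunitary n. \<exists>V \<in> cunitary n. \<exists>s h.
    mat_diag n (\<lambda>i. complex_of_real (\<sigma> i)) * V = P * mat_diag n (\<lambda>i. complex_of_real (s i)) \<and>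
    B * V = P * mat_diag n (\<lambda>i. complex_of_real (h i)) \<and>
    (\<forall>i<n. 0 \<le> s i \<and> (s i = 0 \<longrightarrow> 0 \<le> h i))"
proof -
  define S where "S = mat_diag n (\<lambda>i. complex_of_real (\<sigma> i))"
  define H where "H = mat_adjoint B * B"
  \<comment> \<open>Looking at the row index alone is enough: \<open>B\<close> and \<open>H\<close>
    vanish between indices with different \<open>\<sigma>\<close>, so \<open>G\<close> is block
    diagonal and each block comes from one of the two matrices.\<close>
  define G where "G = mat n n (\<lambda>(i,j). if \<sigma> i \<noteq> 0 then B $$ (i,j) else H $$ (i,j))"
  have S: "S \<in> carrier_mat n n" by (simp add: S_def)
  have H: "H \<in> carrier_mat n n" using B by (auto simp: H_def)
  have G: "G \<in> carrier_mat n n" by (simp add: G_def)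
  have H_index: "H $$ (i,j) = (\<Sum>k<n. cnj (B $$ (k,i)) * B $$ (k,j))" if "i < n" "j < n" for i j
  proof -
    have "H $$ (i,j) = (\<Sum>k<n. mat_adjoint B $$ (i,k) * B $$ (k,j))"
      unfolding H_def by (rule mult_mat_index[of _ n n _ n]) (use B that in auto)
    also have "\<dots> = (\<Sum>k<n. cnj (B $$ (k,i)) * B $$ (k,j))"
      using B that by (intro sum.cong) auto
    finally show ?thesis .
  qed
  have H_comm: "H $$ (i,j) = 0" if "i < n" "j < n" "\<sigma> i \<noteq> \<sigma> j" for i j
    unfolding H_index[OF that(1,2)] 
  proof (rule sum.neutral, rule ballI)
    fix k assume "k \<in> {..<n}"
    then show "cnj (B $$ (k,i)) * B $$ (k,j) = 0"
      using comm[of k i] comm[of k j] that by (cases "\<sigma> k = \<sigma> i") auto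
  qed
  have H_herm: "H $$ (j,i) = cnj (H $$ (i,j))" if "i < n" "j < n" for i j
    using that by (simp add: H_index mult.commute)
  have S_adj: "mat_adjoint S = S"
    by (rule eq_matI) (auto simp: S_def mat_diag_def)
  have G_adj: "mat_adjoint G = G"
  proof (rule eq_matI)
    fix i j assume "i < dim_row G" "j < dim_col G"
    then have ij: "i < n" "j < n" using G by auto
    show "mat_adjoint G $$ (i,j) = G $$ (i,j)"
    proof (cases "\<sigma> i = \<sigma> j")
      case True
      then show ?thesis using ij G herm[OF ij(2,1)] H_herm[OF ij(2,1)] by (auto simp: G_def)
    next
      case False
      then show ?thesis
        using ij G comm[OF ij] comm[OF ij(2,1)] H_comm[OF ij] H_comm[OF ij(2,1)]
        by (auto simp: G_def)
    qed
  qed (use G in auto)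
  have G_comm: "G $$ (i,j) = 0" if "i < n" "j < n" "\<sigma> i \<noteq> \<sigma> j" for i j
    using that comm[OF that] H_comm[OF that] by (simp add: G_def)
  have "S * G = G * S"
    unfolding S_def mat_diag_mult_left[OF G] mat_diag_mult_right[OF G]
  proof (rule cong_mat)
    fix i j assume "i < n" "j < n"
    then show "(case (i,j) of (i,j) \<Rightarrow> complex_of_real (\<sigma> i) * G $$ (i,j))
      = (case (i,j) of (i,j) \<Rightarrow> G $$ (i,j) * complex_of_real (\<sigma> j))"
      using G_comm[of i j] by (cases "\<sigma> i = \<sigma> j") auto
  qed auto
  from commuting_hermitian_diagonalization[OF S S_adj G G_adj this]
  obtain V s g where V: "V \<in> cunitary n"
    and eigS: "\<And>j. j < n \<Longrightarrow> S *\<^sub>v col V j = complex_of_real (s j) \<cdot>\<^sub>v col V j"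
    and eigG: "\<And>j. j < n \<Longrightarrow> G *\<^sub>v col V j = complex_of_real (g j) \<cdot>\<^sub>v col V j" by blast
  note Vc = cunitaryD[OF V]
  have colV: "col V j \<in> carrier_vec n" for j using Vc(1) by auto
  have eq1: "\<sigma> k * V $$ (k,j) = s j * V $$ (k,j)" if "k < n" "j < n" for k j
  proof -
    have "(S *\<^sub>v col V j) $ k = (\<Sum>l<n. S $$ (k,l) * col V j $ l)"
      by (rule mult_mat_vec_index[OF S colV that(1)])
    also have "\<dots> = (\<Sum>l<n. if l = k then \<sigma> k * V $$ (k,j) else 0)"
      using that Vc(1) by (intro sum.cong) (auto simp: S_def mat_diag_def)
    also have "\<dots> = \<sigma> k * V $$ (k,j)" using that by simp
    finally show ?thesis using eigS[OF that(2)] that Vc(1) by auto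
  qed
  have eq2: "(\<Sum>l<n. G $$ (k,l) * V $$ (l,j)) = g j * V $$ (k,j)" if "k < n" "j < n" for k j
  proof -
    have "(G *\<^sub>v col V j) $ k = (\<Sum>l<n. G $$ (k,l) * col V j $ l)"
      by (rule mult_mat_vec_index[OF G colV that(1)])
    also have "\<dots> = (\<Sum>l<n. G $$ (k,l) * V $$ (l,j))"
      using that Vc(1) by (intro sum.cong) auto
    finally show ?thesis using eigG[OF that(2)] that Vc(1) by simp
  qed
  \<comment> \<open>An eigenvector of the diagonal matrix \<open>S\<close> lives on the indices
    where \<open>\<sigma>\<close> equals its eigenvalue. This separates the columns off the kernel
    from those in it.\<close>
  have supp: "\<sigma> k = s j" if "k < n" "j < n" "V $$ (k,j) \<noteq> 0" for k j
    using eq1[OF that(1,2)] that(3) by simp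
  have s_nonneg: "0 \<le> s j" if "j < n" for j
  proof -
    have "(\<Sum>k<n. cnj (V $$ (k,j)) * V $$ (k,j)) \<noteq> 0"
      using cunitary_columns[OF V that that] by simp
    then obtain k where "k < n" "V $$ (k,j) \<noteq> 0"
      by (metis (no_types, lifting) lessThan_iff mult_zero_right sum.neutral)
    then show ?thesis using supp that nonneg by metis
  qed
  define C where "C = B * V"
  have C: "C \<in> carrier_mat n n" using B Vc(1) by (auto simp: C_def)
  have C_index: "C $$ (k,j) = (\<Sum>l<n. B $$ (k,l) * V $$ (l,j))" if "k < n" "j < n" for k j
    unfolding C_def by (rule mult_mat_index[OF B Vc(1) that])
  \<comment> \<open>Off the kernel \<open>V\<close> diagonalizes \<open>B\<close> itself: rows of
    \<open>G\<close> with \<open>\<sigma> k \<noteq> 0\<close> are rows of \<open>B\<close>, and on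
    the other rows both sides vanish by support.\<close>
  have C_range: "C $$ (k,j) = g j * V $$ (k,j)" if "k < n" "j < n" "s j \<noteq> 0" for k j
  proof (cases "\<sigma> k = 0")
    case True
    have "C $$ (k,j) = 0"
      unfolding C_index[OF that(1,2)]
    proof (rule sum.neutral, rule ballI)
      fix l assume "l \<in> {..<n}"
      then show "B $$ (k,l) * V $$ (l,j) = 0"
        using supp[of l j] comm[of k l] that True by (cases "V $$ (l,j) = 0") auto
    qed
    then show ?thesis using supp[OF that(1,2)] that(3) True by auto
  next
    case False
    then have "C $$ (k,j) = (\<Sum>l<n. G $$ (k,l) * V $$ (l,j))"
      unfolding C_index[OF that(1,2)] using that by (intro sum.cong) (auto simp: G_def)
    then show ?thesis using eq2[OF that(1,2)] by simp
  qed
  have C_kernel: "C $$ (k,j) = 0" if "k < n" "j < n" "s j = 0" "\<sigma> k \<noteq> 0" for k j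
    unfolding C_index[OF that(1,2)]
  proof (rule sum.neutral, rule ballI)
    fix l assume "l \<in> {..<n}"
    then show "B $$ (k,l) * V $$ (l,j) = 0"
      using supp[of l j] comm[of k l] that by (cases "V $$ (l,j) = 0") auto
  qed
  \<comment> \<open>The same transfer for kernel columns, now from \<open>G\<close> to
    \<open>H\<close>.\<close>
  have HV: "(\<Sum>l<n. H $$ (k,l) * V $$ (l,j)) = g j * V $$ (k,j)" if "k < n" "j < n" "s j = 0" for k j
  proof (cases "\<sigma> k = 0")
    case True
    then have "(\<Sum>l<n. H $$ (k,l) * V $$ (l,j)) = (\<Sum>l<n. G $$ (k,l) * V $$ (l,j))"
      using that by (intro sum.cong) (auto simp: G_def)
    then show ?thesis using eq2[OF that(1,2)] by simp
  next
    case False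
    have "(\<Sum>l<n. H $$ (k,l) * V $$ (l,j)) = 0"
    proof (rule sum.neutral, rule ballI)
      fix l assume "l \<in> {..<n}"
      then show "H $$ (k,l) * V $$ (l,j) = 0"
        using supp[of l j] H_comm[of k l] that False by (cases "V $$ (l,j) = 0") auto
    qed
    then show ?thesis using supp[OF that(1,2)] that(3) False by auto
  qed
  \<comment> \<open>The Gram matrix of \<open>C\<close> is \<open>V\<^sup>* H V\<close>. Hence a
    kernel column of \<open>C\<close> is orthogonal to every other column and has squared norm
    \<open>g j\<close>, which is thus the square of a singular value of \<open>B\<close>.\<close>
  have CC: "(\<Sum>k<n. cnj (C $$ (k,i)) * C $$ (k,j)) = g j * (if i = j then 1 else 0)"
    if "i < n" "j < n" "s j = 0" for i j
  proof -
    have "(\<Sum>k<n. cnj (C $$ (k,i)) * C $$ (k,j)) = (\<Sum>k<n. mat_adjoint C $$ (i,k) * C $$ (k,j))"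
      using C that by (intro sum.cong) auto
    also have "\<dots> = (mat_adjoint C * C) $$ (i,j)"
      by (rule mult_mat_index[symmetric, of _ n n _ n]) (use C that in auto)
    also have "mat_adjoint C * C = mat_adjoint V * (H * V)"
      unfolding C_def H_def mat_adjoint_mult[OF B Vc(1)]
      using B Vc(1) by (simp add: assoc_mult_mat[of _ n n _ n _ n])
    also have "\<dots> $$ (i,j) = (\<Sum>k<n. mat_adjoint V $$ (i,k) * (H * V) $$ (k,j))"
      by (rule mult_mat_index[of _ n n _ n]) (use H Vc(1) that in auto)
    also have "\<dots> = (\<Sum>k<n. g j * (cnj (V $$ (k,i)) * V $$ (k,j)))"
      using that Vc(1) by (intro sum.cong) (simp_all add: mult_mat_index[OF H Vc(1)] HV del: index_mult_mat)
    also have "\<dots> = g j * (if i = j then 1 else 0)"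
      using cunitary_columns[OF V that(1,2)] by (simp flip: sum_distrib_left)
    finally show ?thesis .
  qed
  have g_eq: "g j = (\<Sum>k<n. (cmod (C $$ (k,j)))\<^sup>2)" if "j < n" "s j = 0" for j
    using CC[OF that(1,1,2)] unfolding sum_cnj_mult_self by (simp del: of_real_sum)
  \<comment> \<open>Left singular vectors: off the kernel they coincide with the right ones, and the
    sign of \<open>g j\<close> stays in the singular value; in the kernel they are normalized images
    under \<open>B\<close>.\<close>
  define U where "U = (\<lambda>k j. if s j \<noteq> 0 then V $$ (k,j) else C $$ (k,j) / sqrt (g j))"
  \<comment> \<open>Where \<open>s j\<close> and \<open>g j\<close> are both zero the image
    \<open>C\<close> has a zero column and determines no left vector; any completing column works
    there.\<close>
  define J where "J = {j. j < n \<and> (s j \<noteq> 0 \<or> g j \<noteq> 0)}"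
  have g_pos: "g j > 0" if "j \<in> J" "s j = 0" for j
    using that g_eq[of j] by (simp add: J_def less_le sum_nonneg)
  have "J \<subseteq> {..<n}" by (auto simp: J_def)
  moreover have "(\<Sum>k<n. cnj (U k i) * U k j) = (if i = j then 1 else 0)"
    if ij: "i \<in> J" "j \<in> J" for i j
  proof -
    have ij': "i < n" "j < n" using ij by (auto simp: J_def)
    consider "s i \<noteq> 0" "s j \<noteq> 0" | "s i \<noteq> 0" "s j = 0" | "s i = 0" "s j \<noteq> 0" | "s i = 0" "s j = 0"
      by blast
    then show ?thesis
    proof cases
      case 1
      then show ?thesis using cunitary_columns[OF V ij'] by (simp add: U_def)
    next
      case 2
      \<comment> \<open>The supports are disjoint: column \<open>i\<close> of \<open>V\<close> lives
        where \<open>\<sigma> \<noteq> 0\<close>, column \<open>j\<close> of \<open>C\<close> where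
        \<open>\<sigma> = 0\<close>.\<close>
      have "cnj (U k i) * U k j = 0" if "k < n" for k
        using 2 supp[of k i] C_kernel[of k j] that ij' by (cases "V $$ (k,i) = 0") (auto simp: U_def)
      then have "(\<Sum>k<n. cnj (U k i) * U k j) = 0" by (intro sum.neutral) blast
      then show ?thesis using 2 by auto
    next
      case 3
      have "cnj (U k i) * U k j = 0" if "k < n" for k
        using 3 supp[of k j] C_kernel[of k i] that ij' by (cases "V $$ (k,j) = 0") (auto simp: U_def)
      then have "(\<Sum>k<n. cnj (U k i) * U k j) = 0" by (intro sum.neutral) blast
      then show ?thesis using 3 by auto
    next
      case 4
      have "(\<Sum>k<n. cnj (U k i) * U k j)
        = (\<Sum>k<n. cnj (C $$ (k,i)) * C $$ (k,j)) / (sqrt (g i) * sqrt (g j))"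
        using 4 by (simp add: U_def sum_divide_distrib)
      also have "\<dots> = (if i = j then 1 else 0)"
        unfolding CC[OF ij' 4(2)] using g_pos[OF ij(2) 4(2)]
        by (auto simp flip: of_real_mult)
      finally show ?thesis .
    qed
  qed
  ultimately obtain P where P: "P \<in> cunitary n" "\<forall>j\<in>J. \<forall>k<n. P $$ (k,j) = U k j"
    using extend_orthonormal_columns[of J n U] by blast
  \<comment> \<open>The value \<open>g j\<close> may be negative when \<open>s j \<noteq> 0\<close>;
    in the kernel the root turns a squared singular value of \<open>B\<close> into a nonnegative
    one.\<close>
  define h where "h = (\<lambda>j. if s j \<noteq> 0 then g j else sqrt (g j))"
  have "S * V = P * mat_diag n (\<lambda>i. complex_of_real (s i))"
    unfolding S_def mat_diag_mult_left[OF Vc(1)] mat_diag_mult_right[OF cunitaryD(1)[OF P(1)]]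
  proof (rule cong_mat)
    fix k j assume kj: "k < n" "j < n"
    show "(case (k,j) of (i,j) \<Rightarrow> complex_of_real (\<sigma> i) * V $$ (i,j))
      = (case (k,j) of (i,j) \<Rightarrow> P $$ (i,j) * complex_of_real (s j))"
      using P(2) kj eq1[OF kj] by (cases "s j = 0") (auto simp: J_def U_def)
  qed auto
  moreover have "B * V = P * mat_diag n (\<lambda>i. complex_of_real (h i))"
    unfolding mat_diag_mult_right[OF cunitaryD(1)[OF P(1)]]
  proof (rule eq_matI)
    fix k j assume "k < dim_row (mat n n (\<lambda>(i,j). P $$ (i,j) * complex_of_real (h j)))"
      "j < dim_col (mat n n (\<lambda>(i,j). P $$ (i,j) * complex_of_real (h j)))"
    then have kj: "k < n" "j < n" by auto
    have "C $$ (k,j) = P $$ (k,j) * h j"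
    proof (cases "s j = 0 \<and> g j = 0")
      case True
      then have "(\<Sum>k<n. (cmod (C $$ (k,j)))\<^sup>2) = 0" using g_eq[OF kj(2)] by simp
      then have "C $$ (k,j) = 0" using kj by (simp add: sum_nonneg_eq_0_iff)
      then show ?thesis using True by (simp add: h_def)
    next
      case False
      then have J: "j \<in> J" using kj by (simp add: J_def)
      then show ?thesis using P(2) kj C_range[OF kj] g_pos[OF J] 
        by (auto simp: h_def U_def)
    qed
    then show "(B * V) $$ (k,j) = mat n n (\<lambda>(i,j). P $$ (i,j) * complex_of_real (h j)) $$ (k,j)"
      using kj by (simp add: C_def[symmetric])
  qed (use B Vc(1) in auto)
  moreover have "0 \<le> s i \<and> (s i = 0 \<longrightarrow> 0 \<le> h i)" if "i < n" for i
    using s_nonneg[OF that] g_eq[OF that] by (simp add: h_def sum_nonneg)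
  ultimately show ?thesis using P(1) V unfolding S_def by blast
qed

text \<open>Skewness of \<open>T\<close> and \<open>R\<close> ties position \<open>(i,j)\<close>
  only to \<open>(j,i)\<close>, so the matrix equation splits into systems of two equations in
  \<open>t i j\<close> and \<open>u i j\<close>. For different \<open>\<sigma>\<close> the
  determinant is, up to sign, the difference of the squares, which is nonzero as
  \<open>\<sigma>\<close> is nonnegative, so both entries can be cleared. For equal nonzero
  \<open>\<sigma>\<close> the skew-Hermitian part can be removed. In the kernel the correction terms
  vanish.\<close>

lemma remove_noncommuting_part:
  fixes \<sigma> :: "nat \<Rightarrow> real" and A :: "complex mat"
  assumes A: "A \<in> carrier_mat n n" and nonneg: "\<And>i. i < n \<Longrightarrow> 0 \<le> \<sigma> i"
  defines "S \<equiv> mat_diag n (\<lambda>i. complex_of_real (\<sigma> i))"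
  shows "\<exists>T \<in> carrier_mat n n. \<exists>R \<in> carrier_mat n n. \<exists>B \<in> carrier_mat n n.
    mat_adjoint T = - T \<and> mat_adjoint R = - R \<and> A = B - T * S + S * R \<and>
    (\<forall>i<n. \<forall>j<n. \<sigma> i \<noteq> \<sigma> j \<longrightarrow> B $$ (i,j) = 0) \<and>
    (\<forall>i<n. \<forall>j<n. \<sigma> i = \<sigma> j \<longrightarrow> \<sigma> i \<noteq> 0 \<longrightarrow> B $$ (j,i) = cnj (B $$ (i,j)))"
proof -
  define a where "a = (\<lambda>i j. A $$ (i,j))"
  define d where "d = (\<lambda>i j. complex_of_real ((\<sigma> j)\<^sup>2 - (\<sigma> i)\<^sup>2))"
  \<comment> \<open>For \<open>\<sigma> i \<noteq> \<sigma> j\<close> this and \<open>u\<close>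
    solve, by Cramer's rule, the equation \<open>b i j = 0\<close> together with the conjugate of
    \<open>b j i = 0\<close>. For equal nonzero values \<open>u\<close> is zero and \<open>t\<close>
    is chosen so that \<open>b i j\<close> is the average of \<open>a i j\<close> and
    \<open>cnj (a j i)\<close>.\<close>
  define t where "t = (\<lambda>i j. if \<sigma> i \<noteq> \<sigma> j then - (\<sigma> j * a i j + \<sigma> i * cnj (a j i)) / d i j
    else if \<sigma> i \<noteq> 0 then (cnj (a j i) - a i j) / (2 * \<sigma> i) else 0)"
  define u where "u = (\<lambda>i j. if \<sigma> i \<noteq> \<sigma> j then - (\<sigma> j * cnj (a j i) + \<sigma> i * a i j) / d i j else 0)"
  \<comment> \<open>Entry of \<open>A + T S - S R\<close>, the required equation solved for
    \<open>B\<close>.\<close>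
  define b where "b = (\<lambda>i j. a i j + t i j * \<sigma> j - \<sigma> i * u i j)"
  have d: "d i j \<noteq> 0" if "i < n" "j < n" "\<sigma> i \<noteq> \<sigma> j" for i j
    using nonneg[OF that(1)] nonneg[OF that(2)] that(3)
    unfolding d_def of_real_eq_0_iff by (simp add: power2_eq_iff_nonneg)
  have d_swap: "cnj (d j i) = - d i j" for i j by (simp add: d_def)
  have t: "cnj (t j i) = - t i j" if "i < n" "j < n" for i j
    using d[OF that] by (auto simp: t_def d_swap field_simps)
  have u: "cnj (u j i) = - u i j" if "i < n" "j < n" for i j
    using d[OF that] by (auto simp: u_def d_swap field_simps)
  have b0: "b i j = 0" if "i < n" "j < n" "\<sigma> i \<noteq> \<sigma> j" for i j
  proof -
    have "d i j * b i j = d i j * a i j - (\<sigma> j * a i j + \<sigma> i * cnj (a j i)) * \<sigma> j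
        + \<sigma> i * (\<sigma> j * cnj (a j i) + \<sigma> i * a i j)"
      using that d[OF that] by (simp add: b_def t_def u_def field_simps)
    also have "\<dots> = 0" by (simp add: d_def algebra_simps power2_eq_square)
    finally show ?thesis using d[OF that] by simp
  qed
  have bh: "b j i = cnj (b i j)" if "\<sigma> i = \<sigma> j" "\<sigma> i \<noteq> 0" for i j
    using that by (simp add: b_def t_def u_def field_simps)
  define T where "T = mat n n (\<lambda>(i,j). t i j)"
  define R where "R = mat n n (\<lambda>(i,j). u i j)"
  define B where "B = mat n n (\<lambda>(i,j). b i j)"
  have carr: "T \<in> carrier_mat n n" "R \<in> carrier_mat n n" "B \<in> carrier_mat n n"
    by (auto simp: T_def R_def B_def)
  have "mat_adjoint T = - T" "mat_adjoint R = - R"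
    by (rule eq_matI; use t u in \<open>simp add: T_def R_def\<close>)+
  moreover have "A = B - T * S + S * R"
    unfolding S_def mat_diag_mult_left[OF carr(2)] mat_diag_mult_right[OF carr(1)]
    by (rule eq_matI) (use A in \<open>auto simp: T_def R_def B_def b_def a_def\<close>)
  moreover have "\<forall>i<n. \<forall>j<n. \<sigma> i \<noteq> \<sigma> j \<longrightarrow> B $$ (i,j) = 0" using b0 by (simp add: B_def)
  moreover have "\<forall>i<n. \<forall>j<n. \<sigma> i = \<sigma> j \<longrightarrow> \<sigma> i \<noteq> 0 \<longrightarrow> B $$ (j,i) = cnj (B $$ (i,j))"
    by (auto simp: B_def intro: bh)
  ultimately show ?thesis using carr by blast
qed

section \<open>Dual complex matrices\<close>

lemma dual_parts [simp]:
  "std_part 0 = 0" "inf_part 0 = 0" "std_part 1 = 1" "inf_part 1 = 0"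
  "std_part (x + y) = std_part x + std_part y" "inf_part (x + y) = inf_part x + inf_part y"
  "std_part (- x) = - std_part x" "inf_part (- x) = - inf_part x"
  "std_part (x * y) = std_part x * std_part y"
  "inf_part (x * y) = std_part x * inf_part y + inf_part x * std_part y"
  "std_part (dual_const a) = a" "inf_part (dual_const a) = 0"
  "std_part dual_eps = 0" "inf_part dual_eps = 1"
  by (auto simp: zero_dual_def one_dual_def plus_dual_def uminus_dual_def times_dual_def
      dual_const_def dual_eps_def)

lemma dual_parts_sum [simp]:
  "std_part (sum f S) = (\<Sum>x\<in>S. std_part (f x))" "inf_part (sum f S) = (\<Sum>x\<in>S. inf_part (f x))"
  by (induction S rule: infinite_finite_induct) auto

lemma dual_mat_dim [simp]:
  "dim_row (dual_mat A B) = dim_row B" "dim_col (dual_mat A B) = dim_col B"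
  by auto

lemma dual_mat_carrier [simp, intro]:
  "B \<in> carrier_mat m n \<Longrightarrow> dual_mat A B \<in> carrier_mat m n"
  by auto

lemma dual_mat_index:
  assumes "i < dim_row A" "j < dim_col A" "i < dim_row B" "j < dim_col B"
  shows "dual_mat A B $$ (i,j) = Dual (A $$ (i,j)) (B $$ (i,j))"
  using assms by (intro dual.expand) auto

lemma std_part_dual_mat [simp]:
  assumes "A \<in> carrier_mat m n" "B \<in> carrier_mat m n"
  shows "map_mat std_part (dual_mat A B) = A" "map_mat inf_part (dual_mat A B) = B"
  by (rule eq_matI; use assms in auto)+

lemma dual_mat_parts: "dual_mat (map_mat std_part X) (map_mat inf_part X) = X"
  by (rule eq_matI) (auto intro: dual.expand)

lemma dual_mat_one: "dual_mat (1\<^sub>m n) (0\<^sub>m n n) = 1\<^sub>m n"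
  by (rule eq_matI) (auto intro: dual.expand)

lemma dual_mat_mult:
  assumes "A \<in> carrier_mat m k" "B \<in> carrier_mat m k" "C \<in> carrier_mat k n" "D \<in> carrier_mat k n"
  shows "dual_mat A B * dual_mat C D = dual_mat (A * C) (A * D + B * C)"
proof (rule eq_matI)
  fix i j assume "i < dim_row (dual_mat (A * C) (A * D + B * C))"
    "j < dim_col (dual_mat (A * C) (A * D + B * C))"
  then have ij: "i < m" "j < n" using assms by auto
  have "(dual_mat A B * dual_mat C D) $$ (i,j) = (\<Sum>l<k. dual_mat A B $$ (i,l) * dual_mat C D $$ (l,j))"
    by (rule mult_mat_index[of _ m k _ n]) (use assms ij in auto)
  also have "\<dots> = (\<Sum>l<k. Dual (A $$ (i,l)) (B $$ (i,l)) * Dual (C $$ (l,j)) (D $$ (l,j)))"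
    using assms ij by (intro sum.cong refl arg_cong2[of _ _ _ _ "(*)"] dual_mat_index) auto
  also have "\<dots> = Dual ((A * C) $$ (i,j)) ((A * D) $$ (i,j) + (B * C) $$ (i,j))"
    unfolding mult_mat_index[OF assms(1,3) ij] mult_mat_index[OF assms(1,4) ij]
      mult_mat_index[OF assms(2,3) ij]
    by (intro dual.expand) (simp add: sum.distrib)
  also have "\<dots> = dual_mat (A * C) (A * D + B * C) $$ (i,j)"
    using assms ij by (subst dual_mat_index) auto
  finally show "(dual_mat A B * dual_mat C D) $$ (i,j) = dual_mat (A * C) (A * D + B * C) $$ (i,j)" .
qed (use assms in auto)

lemma dual_adjoint_dual_mat:
  assumes "A \<in> carrier_mat m n" "B \<in> carrier_mat m n"
  shows "dual_adjoint (dual_mat A B) = dual_mat (mat_adjoint A) (mat_adjoint B)"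
  unfolding dual_adjoint_def std_part_dual_mat[OF assms] ..

lemma dual_adjoint_dim [simp]:
  "dim_row (dual_adjoint A) = dim_col A" "dim_col (dual_adjoint A) = dim_row A"
  by (auto simp: dual_adjoint_def)

lemma dual_adjoint_carrier [simp, intro]:
  "A \<in> carrier_mat m n \<Longrightarrow> dual_adjoint A \<in> carrier_mat n m"
  by (rule carrier_matI) auto

lemma dual_adjoint_adjoint [simp]: "dual_adjoint (dual_adjoint A) = A"
proof -
  define S D where "S = map_mat std_part A" and "D = map_mat inf_part A"
  have c: "S \<in> carrier_mat (dim_row A) (dim_col A)" "D \<in> carrier_mat (dim_row A) (dim_col A)"
    by (auto simp: S_def D_def)
  have A: "A = dual_mat S D" unfolding S_def D_def dual_mat_parts ..
  show ?thesis unfolding A dual_adjoint_dual_mat[OF c]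
    using c by (subst dual_adjoint_dual_mat) auto
qed

lemma dual_mat_cases:
  assumes "X \<in> carrier_mat m n"
  obtains S D where "S \<in> carrier_mat m n" "D \<in> carrier_mat m n" "X = dual_mat S D"
  using assms dual_mat_parts[of X] by (metis map_carrier_mat)

lemma dual_adjoint_mult:
  assumes "X \<in> carrier_mat m k" "Y \<in> carrier_mat k n"
  shows "dual_adjoint (X * Y) = dual_adjoint Y * dual_adjoint X"
proof -
  obtain A B where X: "A \<in> carrier_mat m k" "B \<in> carrier_mat m k" "X = dual_mat A B"
    using dual_mat_cases[OF assms(1)] .
  obtain C D where Y: "C \<in> carrier_mat k n" "D \<in> carrier_mat k n" "Y = dual_mat C D"
    using dual_mat_cases[OF assms(2)] .
  have c: "A * C \<in> carrier_mat m n" "A * D + B * C \<in> carrier_mat m n" using X Y by auto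
  have "mat_adjoint (A * D + B * C)
    = mat_adjoint C * mat_adjoint B + mat_adjoint D * mat_adjoint A"
    using X Y c comm_add_mat[of "mat_adjoint D * mat_adjoint A" n m "mat_adjoint C * mat_adjoint B"]
    by (simp add: mat_adjoint_add[of _ m n] mat_adjoint_mult[of _ m k _ n]
        mult_carrier_mat[of _ n k _ m])
  then show ?thesis
    unfolding X(3) Y(3) dual_mat_mult[OF X(1,2) Y(1,2)] dual_adjoint_dual_mat[OF c]
      dual_adjoint_dual_mat[OF X(1,2)] dual_adjoint_dual_mat[OF Y(1,2)]
    using X(1,2) Y(1,2)
    by (simp add: dual_mat_mult[of _ n k _ _ m] mat_adjoint_mult[of _ m k _ n])
qed

section \<open>Dual unitary matrices and the unsorted decomposition\<close>

lemma dual_unitaryD: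
  assumes "U \<in> dual_unitary n"
  shows "U \<in> carrier_mat n n" "U * dual_adjoint U = 1\<^sub>m n" "dual_adjoint U * U = 1\<^sub>m n"
  using assms by (auto simp: dual_unitary_def inverts_mat_def)

lemma dual_unitaryI:
  assumes "U \<in> carrier_mat n n" "U * dual_adjoint U = 1\<^sub>m n" "dual_adjoint U * U = 1\<^sub>m n"
  shows "U \<in> dual_unitary n"
  using assms by (auto simp: dual_unitary_def inverts_mat_def)

lemma dual_unitary_adjoint:
  assumes "U \<in> dual_unitary n"
  shows "dual_adjoint U \<in> dual_unitary n"
  using dual_unitaryD[OF assms] by (intro dual_unitaryI) auto

lemma dual_unitary_mult:
  assumes "U \<in> dual_unitary n" "W \<in> dual_unitary n"
  shows "U * W \<in> dual_unitary n"
proof -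
  note U = dual_unitaryD[OF assms(1)] and W = dual_unitaryD[OF assms(2)]
  have "W * (dual_adjoint W * dual_adjoint U) = (W * dual_adjoint W) * dual_adjoint U"
    using U(1) W(1) by (simp add: assoc_mult_mat[of _ n n _ n _ n])
  then have 1: "W * (dual_adjoint W * dual_adjoint U) = dual_adjoint U" using W U by simp
  have "dual_adjoint U * (U * W) = (dual_adjoint U * U) * W"
    using U(1) W(1) by (simp add: assoc_mult_mat[of _ n n _ n _ n])
  then have 2: "dual_adjoint U * (U * W) = W" using W U by simp
  show ?thesis
    by (rule dual_unitaryI) (use U W 1 2 in
      \<open>simp_all add: dual_adjoint_mult[OF U(1) W(1)] assoc_mult_mat[of _ n n _ n _ n]
        mult_carrier_mat[of _ n n _ n]\<close>)
qed

lemma cunitary_dual_unitary: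
  assumes "P \<in> cunitary n"
  shows "dual_mat P (0\<^sub>m n n) \<in> dual_unitary n"
proof -
  note P = cunitaryD[OF assms]
  show ?thesis
    by (rule dual_unitaryI)
      (use P in \<open>simp_all add: dual_adjoint_dual_mat[of _ n n] dual_mat_mult[of _ n n _ _ n] dual_mat_one\<close>)
qed

lemma skew_dual_unitary:
  assumes "T \<in> carrier_mat n n" "mat_adjoint T = - T"
  shows "dual_mat (1\<^sub>m n) T \<in> dual_unitary n"
proof -
  have "T + - T = 0\<^sub>m n n" "- T + T = 0\<^sub>m n n"
    by (rule eq_matI; use assms(1) in auto)+
  then show ?thesis
    by (intro dual_unitaryI) (use assms in \<open>simp_all add: dual_adjoint_dual_mat[of _ n n]
      dual_mat_mult[of _ n n _ _ n] dual_mat_one\<close>)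
qed

text \<open>On \<open>S + \<epsilon>B\<close> the unitary factors \<open>1 - \<epsilon>T\<close> and \<open>1 + \<epsilon>R\<close> with skew-Hermitian \<open>T\<close>, \<open>R\<close>
  act by \<open>B \<mapsto> B - T S + S R\<close>.\<close>

lemma dual_svd_unsorted:
  fixes A :: "complex dual mat"
  assumes A: "A \<in> carrier_mat n n"
  shows "\<exists>U \<in> dual_unitary n. \<exists>V \<in> dual_unitary n. \<exists>\<delta>. (\<forall>i<n. 0 \<le> \<delta> i) \<and>
    A = U * mat_diag n (\<lambda>i. dual_complex_of_real (\<delta> i)) * dual_adjoint V"
proof -
  obtain As Ad where As: "As \<in> carrier_mat n n" and Ad: "Ad \<in> carrier_mat n n"
    and A_eq: "A = dual_mat As Ad"
    using dual_mat_cases[OF A] .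
  obtain P V \<sigma> where P: "P \<in> cunitary n" and V: "V \<in> cunitary n"
    and svd: "As * V = P * mat_diag n (\<lambda>i. complex_of_real (\<sigma> i))" and \<sigma>: "\<And>i. i < n \<Longrightarrow> 0 \<le> \<sigma> i"
  proof -
    obtain P V s h where *: "P \<in> cunitary n" "V \<in> cunitary n"
      "mat_diag n (\<lambda>i. complex_of_real 0) * V = P * mat_diag n (\<lambda>i. complex_of_real (s i))"
      "As * V = P * mat_diag n (\<lambda>i. complex_of_real (h i))"
      "\<forall>i<n. 0 \<le> s i \<and> (s i = 0 \<longrightarrow> 0 \<le> h i)"
      using simultaneous_svd[OF As, of "\<lambda>_. 0"] by auto
    \<comment> \<open>With \<open>\<sigma> = 0\<close> the first equation says that \<open>P\<close>
      times the diagonal matrix of \<open>s\<close> is zero. Hence \<open>s\<close> vanishes, and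
      the sign condition becomes \<open>0 \<le> h i\<close> for all \<open>i\<close>: an ordinary
      singular value decomposition of the standard part.\<close>
    have "mat_diag n (\<lambda>i. complex_of_real 0) * V = 0\<^sub>m n n"
      using cunitaryD(1)[OF *(2)] by (subst mat_diag_mult_left) (auto intro!: eq_matI)
    then have "P * mat_diag n (\<lambda>i. complex_of_real (s i)) = 0\<^sub>m n n"
      by (simp only: *(3))
    then have "mat_adjoint P * (P * mat_diag n (\<lambda>i. complex_of_real (s i))) = 0\<^sub>m n n"
      using cunitaryD(1)[OF *(1)] by (simp only: right_mult_zero_mat mat_adjoint_carrier)
    then have D: "mat_diag n (\<lambda>i. complex_of_real (s i)) = 0\<^sub>m n n"
      using cunitaryD[OF *(1)]
      by (simp add: assoc_mult_mat[of _ n n _ n _ n, symmetric] left_mult_one_mat[of _ n n])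
    have "s i = 0" if "i < n" for i
      using that arg_cong[OF D, of "\<lambda>X. X $$ (i,i)"]
      by (simp add: mat_diag_def)
    then show ?thesis using that[OF *(1,2,4)] *(5) by blast
  qed
  note Pc = cunitaryD[OF P] and Vc = cunitaryD[OF V]
  define S where "S = mat_diag n (\<lambda>i. complex_of_real (\<sigma> i))"
  have S: "S \<in> carrier_mat n n" by (simp add: S_def)
  have "mat_adjoint P * (Ad * V) \<in> carrier_mat n n" using Pc Vc Ad by auto
  have "\<exists>T \<in> carrier_mat n n. \<exists>R \<in> carrier_mat n n. \<exists>B \<in> carrier_mat n n.
    mat_adjoint T = - T \<and> mat_adjoint R = - R \<and> mat_adjoint P * (Ad * V) = B - T * S + S * R \<and>
    (\<forall>i<n. \<forall>j<n. \<sigma> i \<noteq> \<sigma> j \<longrightarrow> B $$ (i,j) = 0) \<and>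
    (\<forall>i<n. \<forall>j<n. \<sigma> i = \<sigma> j \<longrightarrow> \<sigma> i \<noteq> 0 \<longrightarrow> B $$ (j,i) = cnj (B $$ (i,j)))"
    unfolding S_def
    by (rule remove_noncommuting_part) (fact \<open>mat_adjoint P * (Ad * V) \<in> _\<close>, fact \<sigma>)
  then obtain T R B
    where T: "T \<in> carrier_mat n n" "mat_adjoint T = - T"
      and R: "R \<in> carrier_mat n n" "mat_adjoint R = - R" and B: "B \<in> carrier_mat n n"
      and B_eq: "mat_adjoint P * (Ad * V) = B - T * S + S * R"
      and B_comm: "\<forall>i<n. \<forall>j<n. \<sigma> i \<noteq> \<sigma> j \<longrightarrow> B $$ (i,j) = 0"
      and B_herm: "\<forall>i<n. \<forall>j<n. \<sigma> i = \<sigma> j \<longrightarrow> \<sigma> i \<noteq> 0 \<longrightarrow> B $$ (j,i) = cnj (B $$ (i,j))"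
    by blast
  have "\<exists>Q \<in> cunitary n. \<exists>W \<in> cunitary n. \<exists>s h.
    S * W = Q * mat_diag n (\<lambda>i. complex_of_real (s i)) \<and>
    B * W = Q * mat_diag n (\<lambda>i. complex_of_real (h i)) \<and>
    (\<forall>i<n. 0 \<le> s i \<and> (s i = 0 \<longrightarrow> 0 \<le> h i))"
    unfolding S_def by (rule simultaneous_svd[OF B]; use \<sigma> B_comm B_herm in blast)
  then obtain Q W s h
    where Q: "Q \<in> cunitary n" and W: "W \<in> cunitary n"
      and SW: "S * W = Q * mat_diag n (\<lambda>i. complex_of_real (s i))"
      and BW: "B * W = Q * mat_diag n (\<lambda>i. complex_of_real (h i))"
      and sh: "\<forall>i<n. 0 \<le> s i \<and> (s i = 0 \<longrightarrow> 0 \<le> h i)"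
    by blast
  note Qc = cunitaryD[OF Q] and Wc = cunitaryD[OF W]
  let ?D = "\<lambda>X. dual_mat X (0\<^sub>m n n)"
  define U1 where "U1 = ?D P * dual_mat (1\<^sub>m n) (- T)"
  \<comment> \<open>The sign is that of \<open>- R\<close> because the adjoint of \<open>V1\<close>
    enters the decomposition, and the adjoint of \<open>1 - \<epsilon>R\<close> is
    \<open>1 + \<epsilon>R\<close>.\<close>
  define V1 where "V1 = ?D V * dual_mat (1\<^sub>m n) (- R)"
  \<comment> \<open>One pair \<open>Q\<close>, \<open>W\<close> diagonalizes \<open>S\<close> and
    \<open>B\<close> together, so the dual matrix itself becomes diagonal.\<close>
  define \<Delta> where "\<Delta> = dual_mat (mat_diag n (\<lambda>i. complex_of_real (s i))) (mat_diag n (\<lambda>i. complex_of_real (h i)))"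
  have skew: "dual_mat (1\<^sub>m n) (- X) \<in> dual_unitary n"
    if "X \<in> carrier_mat n n" "mat_adjoint X = - X" for X
  proof (rule skew_dual_unitary)
    have "mat_adjoint (- X) = - mat_adjoint X" using that(1) by (auto intro!: eq_matI)
    then show "mat_adjoint (- X) = - (- X)" using that(2) by simp
  qed (use that in auto)
  have U1: "U1 \<in> dual_unitary n" unfolding U1_def
    by (intro dual_unitary_mult cunitary_dual_unitary P skew T)
  have V1: "V1 \<in> dual_unitary n" unfolding V1_def
    by (intro dual_unitary_mult cunitary_dual_unitary V skew R)
  have TS: "T * S \<in> carrier_mat n n" and SR: "S * R \<in> carrier_mat n n" using T R S by auto
  have AV: "A * ?D V = ?D P * dual_mat S (B - T * S + S * R)"
  proof -
    have "P * (B - T * S + S * R) = Ad * V"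
      unfolding B_eq[symmetric] using Pc Vc(1) Ad
        assoc_mult_mat[of P n n "mat_adjoint P" n "Ad * V" n, symmetric]
      by (simp add: mult_carrier_mat[of _ n n _ n] left_mult_one_mat[of _ n n])
    moreover have "B - T * S + S * R \<in> carrier_mat n n" using B TS SR by auto
    ultimately show ?thesis
      unfolding A_eq using As Ad Pc(1) Vc(1) S svd[folded S_def]
      by (simp add: dual_mat_mult[of _ n n _ _ n])
  qed
  have "A * V1 = A * ?D V * dual_mat (1\<^sub>m n) (- R)"
    unfolding V1_def using A Vc(1) R(1) by (intro assoc_mult_mat[symmetric, of _ n n _ n _ n]) auto
  also have "\<dots> = ?D P * (dual_mat S (B - T * S + S * R) * dual_mat (1\<^sub>m n) (- R))"
    unfolding AV using Pc(1) R(1) S SR by (intro assoc_mult_mat[of _ n n _ n _ n]) auto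
  also have "dual_mat S (B - T * S + S * R) * dual_mat (1\<^sub>m n) (- R) = dual_mat S (B - T * S)"
  proof -
    have "- Y + (B - X + Y) = B - X" if "X \<in> carrier_mat n n" "Y \<in> carrier_mat n n" for X Y
      by (rule eq_matI) (use B that in auto)
    note this[OF TS SR]
    then show ?thesis
      using S B TS SR R(1) by (simp add: dual_mat_mult[of _ n n _ _ n])
  qed
  also have "\<dots> = dual_mat (1\<^sub>m n) (- T) * dual_mat S B"
  proof -
    have "B + - X = B - X" if "X \<in> carrier_mat n n" for X
      by (rule eq_matI) (use B that in auto)
    note this[OF TS]
    then show ?thesis
      using S B TS T(1) by (simp add: dual_mat_mult[of _ n n _ _ n])
  qed
  also have "?D P * \<dots> = U1 * dual_mat S B"
    unfolding U1_def using Pc(1) T(1) S B by (intro assoc_mult_mat[symmetric, of _ n n _ n _ n]) auto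
  finally have AV1: "A * V1 = U1 * dual_mat S B" .
  have SBW: "dual_mat S B * ?D W = ?D Q * \<Delta>"
    unfolding \<Delta>_def using S B Wc(1) Qc(1) SW BW
    by (simp add: dual_mat_mult[of _ n n _ _ n] left_mult_zero_mat[of _ n n]
        right_add_zero_mat[of _ n n] mult_carrier_mat[of _ n n _ n])
  define U2 where "U2 = U1 * ?D Q"
  define V2 where "V2 = V1 * ?D W"
  have U2: "U2 \<in> dual_unitary n" unfolding U2_def
    by (intro dual_unitary_mult cunitary_dual_unitary U1 Q)
  have V2: "V2 \<in> dual_unitary n" unfolding V2_def
    by (intro dual_unitary_mult cunitary_dual_unitary V1 W)
  have \<Delta>: "\<Delta> \<in> carrier_mat n n" by (simp add: \<Delta>_def)
  have "A * V2 = A * V1 * ?D W"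
    unfolding V2_def using A dual_unitaryD(1)[OF V1]
    by (intro assoc_mult_mat[symmetric, of _ n n _ n _ n]) auto
  also have "\<dots> = U1 * (dual_mat S B * ?D W)"
    unfolding AV1 using B dual_unitaryD(1)[OF U1] by (intro assoc_mult_mat[of _ n n _ n _ n]) auto
  also have "\<dots> = U2 * \<Delta>"
    unfolding SBW U2_def using \<Delta> dual_unitaryD(1)[OF U1]
    by (intro assoc_mult_mat[symmetric, of _ n n _ n _ n]) auto
  finally have "A * V2 * dual_adjoint V2 = U2 * \<Delta> * dual_adjoint V2" by simp
  then have A_eq: "A = U2 * \<Delta> * dual_adjoint V2"
    using A dual_unitaryD[OF V2] by (simp add: assoc_mult_mat[of A n n _ n _ n])
  define \<delta> where "\<delta> = (\<lambda>i. Dual (s i) (h i))"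
  have "\<Delta> = mat_diag n (\<lambda>i. dual_complex_of_real (\<delta> i))"
    unfolding \<Delta>_def \<delta>_def by (rule eq_matI) (auto simp: mat_diag_def intro: dual.expand)
  then have "A = U2 * mat_diag n (\<lambda>i. dual_complex_of_real (\<delta> i)) * dual_adjoint V2"
    using A_eq by simp
  \<comment> \<open>In the lexicographic order \<open>s i > 0\<close> settles the sign, and for
    \<open>s i = 0\<close> the bound on \<open>h i\<close> takes over.\<close>
  moreover have "\<forall>i<n. 0 \<le> \<delta> i"
    using sh by (auto simp: \<delta>_def less_eq_dual_def less_le)
  ultimately show ?thesis using U2 V2 by blast
qed

section \<open>Sorting the singular values\<close>

lemma dual_adjoint_index:
  assumes "i < dim_col A" "j < dim_row A"
  shows "dual_adjoint A $$ (i,j) = map_dual cnj (A $$ (j,i))"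
proof -
  have "dual_adjoint A $$ (i,j) = Dual (cnj (std_part (A $$ (j,i)))) (cnj (inf_part (A $$ (j,i))))"
    unfolding dual_adjoint_def using assms by (subst dual_mat_index) auto
  then show ?thesis by (simp add: dual.map_sel dual.expand)
qed

text \<open>One product with the adjoint only reorders the sum over columns; the other is the old
  identity with relabelled rows and columns, and stays an identity as \<open>p\<close> is
  injective.\<close>

lemma dual_unitary_permute_columns:
  assumes U: "U \<in> dual_unitary n" and p: "p permutes {..<n}"
  shows "mat n n (\<lambda>(i,j). U $$ (i, p j)) \<in> dual_unitary n"
proof -
  note Uc = dual_unitaryD[OF U]
  define W where "W = mat n n (\<lambda>(i,j). U $$ (i, p j))"
  have W: "W \<in> carrier_mat n n" by (simp add: W_def)
  have p_less: "p j < n" if "j < n" for j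
    using permutes_in_image[OF p] that by auto
  have adj: "dual_adjoint W $$ (i,j) = dual_adjoint U $$ (p i, j)" if "i < n" "j < n" for i j
    using that p_less Uc(1) by (simp add: dual_adjoint_index W_def)
  have U_adj: "dual_adjoint U \<in> carrier_mat n n" and W_adj: "dual_adjoint W \<in> carrier_mat n n"
    using Uc(1) W by auto
  have "W * dual_adjoint W = 1\<^sub>m n"
  proof (rule eq_matI)
    fix i j assume "i < dim_row (1\<^sub>m n :: complex dual mat)" "j < dim_col (1\<^sub>m n :: complex dual mat)"
    then have ij: "i < n" "j < n" by auto
    have "(W * dual_adjoint W) $$ (i,j) = (\<Sum>k<n. U $$ (i, p k) * dual_adjoint U $$ (p k, j))"
      unfolding mult_mat_index[OF W W_adj ij] using ij adj by (intro sum.cong) (auto simp: W_def)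
    also have "\<dots> = (\<Sum>k<n. U $$ (i, k) * dual_adjoint U $$ (k, j))"
      using sum.permute[OF p, of "\<lambda>k. U $$ (i, k) * dual_adjoint U $$ (k, j)"] by (simp add: comp_def)
    also have "\<dots> = (U * dual_adjoint U) $$ (i,j)"
      by (rule mult_mat_index[OF Uc(1) U_adj ij, symmetric])
    finally show "(W * dual_adjoint W) $$ (i,j) = 1\<^sub>m n $$ (i,j)" using Uc(2) by simp
  qed (use W in auto)
  moreover have "dual_adjoint W * W = 1\<^sub>m n"
  proof (rule eq_matI)
    fix i j assume "i < dim_row (1\<^sub>m n :: complex dual mat)" "j < dim_col (1\<^sub>m n :: complex dual mat)"
    then have ij: "i < n" "j < n" by auto
    have "(dual_adjoint W * W) $$ (i,j) = (\<Sum>k<n. dual_adjoint U $$ (p i, k) * U $$ (k, p j))"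
      unfolding mult_mat_index[OF W_adj W ij] using ij adj by (intro sum.cong) (auto simp: W_def)
    also have "\<dots> = (dual_adjoint U * U) $$ (p i, p j)"
      by (rule mult_mat_index[OF U_adj Uc(1) p_less[OF ij(1)] p_less[OF ij(2)], symmetric])
    finally show "(dual_adjoint W * W) $$ (i,j) = 1\<^sub>m n $$ (i,j)"
      using Uc(3) ij p_less permutes_inj[OF p] by (simp add: inj_eq)
  qed (use W in auto)
  ultimately show ?thesis using W dual_unitaryI unfolding W_def by blast
qed

lemma sorting_permutation:
  fixes f :: "nat \<Rightarrow> 'a :: linorder"
  shows "\<exists>p. p permutes {..<n} \<and> (\<forall>i j. i \<le> j \<and> j < n \<longrightarrow> f (p j) \<le> f (p i))"
proof -
  define xs where "xs = map f [0..<n]"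
  have "mset (rev (sort xs)) = mset xs" by simp
  then obtain p where p: "p permutes {..<length xs}" "permute_list p xs = rev (sort xs)"
    using mset_eq_permutation by metis
  have "f (p j) \<le> f (p i)" if "i \<le> j" "j < n" for i j
  proof -
    have nth: "rev (sort xs) ! k = f (p k)" if "k < n" for k
      unfolding p(2)[symmetric] using that p(1) permutes_in_image[OF p(1), of k]
      by (simp add: permute_list_nth xs_def)
    have "sorted (sort xs)" by simp
    then have "rev (sort xs) ! j \<le> rev (sort xs) ! i"
      using that sorted_rev_nth_mono[of "rev (sort xs)" i j] by (simp add: xs_def)
    then show ?thesis using nth that by simp
  qed
  then show ?thesis using p(1) by (auto simp: xs_def)
qed

text \<open>A member \<open>j\<close> brings \<open>j + 1\<close> members along, so it lies below
  the cardinality. This converts the sets of appreciable and of positive singular values of a sorted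
  list into index ranges.\<close>

lemma downward_closed_eq_lessThan:
  assumes "I \<subseteq> {..<n::nat}" "\<And>i j. i \<le> j \<Longrightarrow> j \<in> I \<Longrightarrow> i \<in> I"
  shows "I = {..<card I}"
proof -
  have fin: "finite I" using assms(1) finite_subset by blast
  have "I \<subseteq> {..<card I}"
  proof
    fix j assume "j \<in> I"
    then have "{..j} \<subseteq> I" using assms(2) by auto
    then have "card {..j} \<le> card I" by (rule card_mono[OF fin])
    then show "j \<in> {..<card I}" by simp
  qed
  then show ?thesis using fin by (intro card_subset_eq) auto
qed

lemma four_block_diag_zero:
  assumes "t \<le> n"
  shows "four_block_mat (mat_diag t f) (0\<^sub>m t (n - t)) (0\<^sub>m (n - t) t) (0\<^sub>m (n - t) (n - t))
    = mat_diag n (\<lambda>i. if i < t then f i else 0)"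
  by (rule eq_matI) (use assms in \<open>auto simp: mat_diag_def\<close>)

lemma is_dual_svd_square_iff:
  assumes "A \<in> carrier_mat n n"
  shows "is_dual_svd A r t P \<mu> V \<longleftrightarrow>
     r \<le> t \<and> t \<le> n \<and> P \<in> dual_unitary n \<and> V \<in> dual_unitary n \<and>
     (\<forall>i<r. appreciable (\<mu> i) \<and> 0 < \<mu> i) \<and>
     (\<forall>i. r \<le> i \<and> i < t \<longrightarrow> infinitesimal (\<mu> i) \<and> 0 < \<mu> i) \<and>
     (\<forall>i j. i \<le> j \<and> j < r \<longrightarrow> \<mu> j \<le> \<mu> i) \<and>
     (\<forall>i j. r \<le> i \<and> i \<le> j \<and> j < t \<longrightarrow> \<mu> j \<le> \<mu> i) \<and>
     A = P * mat_diag n (\<lambda>i. if i < t then dual_complex_of_real (\<mu> i) else 0) * dual_adjoint V"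
proof -
  have "dim_row A = n" "dim_col A = n" using assms by auto
  then show ?thesis
    unfolding is_dual_svd_def Let_def by (cases "t \<le> n") (simp_all add: four_block_diag_zero)
qed

lemma mult_diag_mult_index:
  assumes "U \<in> carrier_mat n n" "V \<in> carrier_mat n n" "i < n" "j < n"
  shows "(U * mat_diag n d * V) $$ (i,j) = (\<Sum>k<n. U $$ (i,k) * d k * V $$ (k,j))"
  unfolding mat_diag_mult_right[OF assms(1)]
  by (subst mult_mat_index[of _ n n _ n]) (use assms in auto)

text \<open>Descending order of dual numbers puts appreciable values before infinitesimal ones and
  positive values before zeros. Hence \<open>r\<close> and \<open>t\<close> can be taken as the
  numbers of appreciable and of positive values.\<close>

lemma dual_svd_exists:
  fixes A :: "complex dual mat"
  assumes A: "A \<in> carrier_mat n n"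
  shows "\<exists>r t P \<mu> V. is_dual_svd A r t P \<mu> V"
proof -
  obtain U V \<delta> where U: "U \<in> dual_unitary n" and V: "V \<in> dual_unitary n"
    and \<delta>: "\<And>i. i < n \<Longrightarrow> 0 \<le> \<delta> i"
    and A_eq: "A = U * mat_diag n (\<lambda>i. dual_complex_of_real (\<delta> i)) * dual_adjoint V"
    using dual_svd_unsorted[OF A] by blast
  obtain p where p: "p permutes {..<n}"
    and sorted: "\<And>i j. i \<le> j \<Longrightarrow> j < n \<Longrightarrow> \<delta> (p j) \<le> \<delta> (p i)"
    using sorting_permutation[of n \<delta>] by blast
  have p_less: "p j < n" if "j < n" for j
    using permutes_in_image[OF p] that by auto
  define P where "P = mat n n (\<lambda>(i,j). U $$ (i, p j))"
  define Q where "Q = mat n n (\<lambda>(i,j). V $$ (i, p j))"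
  define e where "e = (\<lambda>i. \<delta> (p i))"
  have P: "P \<in> dual_unitary n" unfolding P_def by (rule dual_unitary_permute_columns[OF U p])
  have Q: "Q \<in> dual_unitary n" unfolding Q_def by (rule dual_unitary_permute_columns[OF V p])
  have e_nonneg: "0 \<le> e i" if "i < n" for i using \<delta> p_less that by (simp add: e_def)
  have e_sorted: "e j \<le> e i" if "i \<le> j" "j < n" for i j using sorted[OF that] by (simp add: e_def)
  define R where "R = {i. i < n \<and> appreciable (e i)}"
  define T where "T = {i. i < n \<and> 0 < e i}"
  have "R = {..<card R}"
  proof (rule downward_closed_eq_lessThan[of _ n])
    fix i j assume "i \<le> j" "j \<in> R"
    then show "i \<in> R" using e_sorted[of i j] e_nonneg[of j]
      by (auto simp: R_def appreciable_def less_eq_dual_def)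
  qed (auto simp: R_def)
  then have R: "i < card R \<longleftrightarrow> i < n \<and> appreciable (e i)" for i
    unfolding R_def by blast
  have "T = {..<card T}"
  proof (rule downward_closed_eq_lessThan[of _ n])
    fix i j assume "i \<le> j" "j \<in> T"
    then show "i \<in> T" using e_sorted[of i j] by (auto simp: T_def)
  qed (auto simp: T_def)
  then have T: "i < card T \<longleftrightarrow> i < n \<and> 0 < e i" for i
    unfolding T_def by blast
  have e_pos: "0 < e i" if "i < n" "appreciable (e i)" for i
    using e_nonneg[OF that(1)] that(2) by (auto simp: appreciable_def order.order_iff_strict)
  have "T \<subseteq> {..<n}" "R \<subseteq> T" using e_pos by (auto simp: T_def R_def)
  then have le: "card T \<le> n" "card R \<le> card T"
    using card_mono[of "{..<n}" T] card_mono[of T R] finite_subset[of T "{..<n}"] by auto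
  \<comment> \<open>Both factors are permuted by the same \<open>p\<close> as the diagonal, so only
    the order of summation over the diagonal changes.\<close>
  have "A = P * mat_diag n (\<lambda>i. dual_complex_of_real (e i)) * dual_adjoint Q"
  proof (rule eq_matI)
    fix i j assume "i < dim_row (P * mat_diag n (\<lambda>i. dual_complex_of_real (e i)) * dual_adjoint Q)"
      "j < dim_col (P * mat_diag n (\<lambda>i. dual_complex_of_real (e i)) * dual_adjoint Q)"
    then have ij: "i < n" "j < n" by (auto simp: P_def Q_def)
    have V_adj: "dual_adjoint V \<in> carrier_mat n n" and Q_adj: "dual_adjoint Q \<in> carrier_mat n n"
      using dual_unitaryD(1)[OF V] dual_unitaryD(1)[OF Q] by auto
    have adj: "dual_adjoint Q $$ (k,j) = dual_adjoint V $$ (p k, j)" if "k < n" for k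
      using that ij p_less dual_unitaryD(1)[OF V] by (simp add: dual_adjoint_index Q_def)
    have "A $$ (i,j) = (\<Sum>k<n. U $$ (i,k) * dual_complex_of_real (\<delta> k) * dual_adjoint V $$ (k,j))"
      unfolding A_eq by (rule mult_diag_mult_index[OF dual_unitaryD(1)[OF U] V_adj ij])
    also have "\<dots> = (\<Sum>k<n. U $$ (i, p k) * dual_complex_of_real (\<delta> (p k)) * dual_adjoint V $$ (p k, j))"
      using sum.permute[OF p, of "\<lambda>k. U $$ (i,k) * dual_complex_of_real (\<delta> k) * dual_adjoint V $$ (k,j)"]
      by (simp add: comp_def)
    also have "\<dots> = (\<Sum>k<n. P $$ (i,k) * dual_complex_of_real (e k) * dual_adjoint Q $$ (k,j))"
      using ij adj by (intro sum.cong) (auto simp: P_def e_def)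
    also have "\<dots> = (P * mat_diag n (\<lambda>i. dual_complex_of_real (e i)) * dual_adjoint Q) $$ (i,j)"
      by (rule mult_diag_mult_index[OF dual_unitaryD(1)[OF P] Q_adj ij, symmetric])
    finally show "A $$ (i,j) = (P * mat_diag n (\<lambda>i. dual_complex_of_real (e i)) * dual_adjoint Q) $$ (i,j)" .
  qed (use A in \<open>auto simp: P_def Q_def\<close>)
  moreover have "mat_diag n (\<lambda>i. dual_complex_of_real (e i))
    = mat_diag n (\<lambda>i. if i < card T then dual_complex_of_real (e i) else 0)"
  proof -
    have "e i = 0" if "i < n" "\<not> i < card T" for i
      using that T[of i] e_nonneg[of i] by auto
    then show ?thesis
      by (intro eq_matI) (auto simp: mat_diag_def dual.map_sel intro!: dual.expand)
  qed
  moreover have "infinitesimal (e i)" if "card R \<le> i" "i < card T" for i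
  proof -
    have "\<not> i < card R" using that(1) by simp
    then show ?thesis using R[of i] T[of i] that(2) by (simp add: infinitesimal_def appreciable_def)
  qed
  ultimately have "is_dual_svd A (card R) (card T) P e Q"
    unfolding is_dual_svd_square_iff[OF A]
    using P Q le R T e_pos e_sorted by auto
  then show ?thesis by blast
qed

section \<open>Uniqueness of the ranks and the decomposition\<close>

text \<open>The first \<open>k\<close> columns of an invertible matrix are independent, yet only
  their first \<open>l\<close> coordinates can be nonzero. For \<open>l < k\<close> some nontrivial
  combination of them would be zero.\<close>

lemma leading_columns_bound:
  fixes X :: "'a :: field mat"
  assumes X: "X \<in> carrier_mat n n" and Z: "Z \<in> carrier_mat n n" "Z * X = 1\<^sub>m n"
    and k: "k \<le> n"
    and zero: "\<And>i j. l \<le> i \<Longrightarrow> i < n \<Longrightarrow> j < k \<Longrightarrow> X $$ (i,j) = 0"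
  shows "k \<le> l"
proof (rule ccontr)
  assume "\<not> k \<le> l"
  then have "card {..<l} < k" by simp
  from underdetermined_system[OF _ this, of "\<lambda>i j. X $$ (i,j)"]
  obtain x where x: "x \<in> carrier_vec k" "x \<noteq> 0\<^sub>v k" "\<And>i. i < l \<Longrightarrow> (\<Sum>j<k. X $$ (i,j) * x $ j) = 0"
    by auto
  define y where "y = vec n (\<lambda>i. if i < k then x $ i else 0)"
  have y: "y \<in> carrier_vec n" by (simp add: y_def)
  have "X *\<^sub>v y = 0\<^sub>v n"
  proof (rule eq_vecI)
    fix i assume "i < dim_vec (0\<^sub>v n :: 'a vec)"
    then have i: "i < n" by simp
    have "(X *\<^sub>v y) $ i = (\<Sum>j<n. X $$ (i,j) * y $ j)" by (rule mult_mat_vec_index[OF X y i])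
    also have "\<dots> = (\<Sum>j<k. X $$ (i,j) * x $ j)"
      using k by (intro sum.mono_neutral_cong_right) (auto simp: y_def)
    also have "\<dots> = 0" using x(3)[of i] zero[of i] i by (cases "i < l") auto
    finally show "(X *\<^sub>v y) $ i = 0\<^sub>v n $ i" using i by simp
  qed (use X in auto)
  moreover have "Z *\<^sub>v 0\<^sub>v n = 0\<^sub>v n" using Z(1) by (intro eq_vecI) auto
  ultimately have "(Z * X) *\<^sub>v y = 0\<^sub>v n"
    using X Z(1) y by (simp add: assoc_mult_mat_vec[of _ n n _ n])
  then have "y = 0\<^sub>v n" using Z(2) y by simp
  moreover obtain i where "i < k" "x $ i \<noteq> 0"
    using x(1,2) by (metis eq_vecI carrier_vecD index_zero_vec)
  then have "y $ i \<noteq> 0" "i < n" using k by (auto simp: y_def)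
  ultimately show False by simp
qed

text \<open>Comparison of parts in \<open>U U\<^sup>* = 1\<close>: the standard part is unitary, and
  the infinitesimal part is tangent to the unitary group there.\<close>

lemma dual_unitary_parts:
  assumes "dual_mat A B \<in> dual_unitary n" "A \<in> carrier_mat n n" "B \<in> carrier_mat n n"
  shows "A * mat_adjoint A = 1\<^sub>m n" "mat_adjoint A * A = 1\<^sub>m n"
    "A * mat_adjoint B + B * mat_adjoint A = 0\<^sub>m n n"
proof -
  have std: "A1 = A2" "B1 = B2" if "dual_mat A1 B1 = dual_mat A2 B2"
    "A1 \<in> carrier_mat n n" "B1 \<in> carrier_mat n n" "A2 \<in> carrier_mat n n" "B2 \<in> carrier_mat n n"
    for A1 A2 B1 B2
    using that std_part_dual_mat by metis+
  note adj = mat_adjoint_carrier[OF assms(2)] mat_adjoint_carrier[OF assms(3)]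
  have 1: "dual_mat (A * mat_adjoint A) (A * mat_adjoint B + B * mat_adjoint A)
      = dual_mat (1\<^sub>m n) (0\<^sub>m n n)"
    using dual_unitaryD(2)[OF assms(1)]
    unfolding dual_adjoint_dual_mat[OF assms(2,3)] dual_mat_mult[OF assms(2,3) adj] dual_mat_one .
  have 2: "dual_mat (mat_adjoint A * A) (mat_adjoint A * B + mat_adjoint B * A)
      = dual_mat (1\<^sub>m n) (0\<^sub>m n n)"
    using dual_unitaryD(3)[OF assms(1)]
    unfolding dual_adjoint_dual_mat[OF assms(2,3)] dual_mat_mult[OF adj assms(2,3)] dual_mat_one .
  show "A * mat_adjoint A = 1\<^sub>m n" "A * mat_adjoint B + B * mat_adjoint A = 0\<^sub>m n n"
    by (rule std[OF 1]; use assms(2,3) adj in auto)+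
  show "mat_adjoint A * A = 1\<^sub>m n"
    by (rule std[OF 2]; use assms(2,3) adj in auto)
qed

text \<open>Two decompositions of \<open>A\<close> yield \<open>X S = S' Y\<close> with \<open>X = P'\<^sup>* P\<close> and \<open>Y = V'\<^sup>* V\<close>, where the rows
  of \<open>S' Y\<close> beyond the rank of \<open>S'\<close> vanish.\<close>

lemma dual_svd_ranks_le:
  assumes A: "A \<in> carrier_mat n n"
    and svd: "is_dual_svd A r t P \<mu> V" "is_dual_svd A r' t' P' \<mu>' V'"
  shows "r \<le> r'" "t \<le> t'"
proof -
  define d where "d = (\<lambda>i. if i < t then dual_complex_of_real (\<mu> i) else 0)"
  define d' where "d' = (\<lambda>i. if i < t' then dual_complex_of_real (\<mu>' i) else 0)"
  note svd = svd[unfolded is_dual_svd_square_iff[OF A]]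
  have P: "P \<in> dual_unitary n" and V: "V \<in> dual_unitary n"
    and P': "P' \<in> dual_unitary n" and V': "V' \<in> dual_unitary n" using svd by auto
  note Pc = dual_unitaryD[OF P] and Vc = dual_unitaryD[OF V]
    and P'c = dual_unitaryD[OF P'] and V'c = dual_unitaryD[OF V']
  have A1: "A = P * mat_diag n d * dual_adjoint V" and A2: "A = P' * mat_diag n d' * dual_adjoint V'"
    using svd by (auto simp: d_def d'_def)
  define X where "X = dual_adjoint P' * P"
  define Y where "Y = dual_adjoint V' * V"
  have X: "X \<in> dual_unitary n" unfolding X_def by (intro dual_unitary_mult dual_unitary_adjoint P P')
  have Y: "Y \<in> carrier_mat n n" using V'c(1) Vc(1) by (auto simp: Y_def)
  have "dual_adjoint P' * (P * mat_diag n d * dual_adjoint V) * V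
    = dual_adjoint P' * (P' * mat_diag n d' * dual_adjoint V') * V"
    using A1 A2 by simp
  moreover have "dual_adjoint P' * (P * mat_diag n d * dual_adjoint V) * V = X * mat_diag n d"
    unfolding X_def using Pc(1) P'c(1) Vc
    by (simp add: assoc_mult_mat[of _ n n _ n _ n] mult_carrier_mat[of _ n n _ n]
        right_mult_one_mat[of _ n n])
  moreover have "dual_adjoint P' * (P' * mat_diag n d' * dual_adjoint V') * V = mat_diag n d' * Y"
  proof -
    have "dual_adjoint P' * (P' * mat_diag n d' * dual_adjoint V') * V
      = (dual_adjoint P' * P') * (mat_diag n d' * (dual_adjoint V' * V))"
      using P'c(1) Vc(1) V'c(1)
      by (simp add: assoc_mult_mat[of _ n n _ n _ n] mult_carrier_mat[of _ n n _ n])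
    then show ?thesis unfolding P'c(3) Y_def using Vc(1) V'c(1) 
      by (simp add: mult_carrier_mat[of _ n n _ n] left_mult_one_mat[of _ n n])
  qed
  ultimately have XY: "X * mat_diag n d = mat_diag n d' * Y" by simp
  have eq: "X $$ (i,j) * d j = d' i * Y $$ (i,j)" if "i < n" "j < n" for i j
    using arg_cong[OF XY, of "\<lambda>M. M $$ (i,j)"] that dual_unitaryD(1)[OF X] Y
    by (simp add: mat_diag_mult_left[of _ n n] mat_diag_mult_right[of _ n n])
  obtain Xs Xd where Xs: "Xs \<in> carrier_mat n n" "Xd \<in> carrier_mat n n" "X = dual_mat Xs Xd"
    using dual_mat_cases[OF dual_unitaryD(1)[OF X]] .
  have X_index: "X $$ (i,j) = Dual (Xs $$ (i,j)) (Xd $$ (i,j))" if "i < n" "j < n" for i j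
    unfolding Xs(3) using that Xs(1,2) by (intro dual_mat_index) auto
  have inv: "mat_adjoint Xs * Xs = 1\<^sub>m n"
    using X Xs by (intro dual_unitary_parts(2)[of Xs Xd]) auto
  have std_pos: "std_part (\<mu> j) \<noteq> 0" if "j < r" for j
    using svd(1) that by (auto simp: appreciable_def)
  have pos: "\<mu> j \<noteq> 0" if "j < t" for j
  proof -
    have "0 < \<mu> j" using svd(1) that not_less by metis
    then show ?thesis by auto
  qed
  have std_d': "std_part (d' i) = 0" if "r' \<le> i" for i
    using svd(2) that by (auto simp: d'_def infinitesimal_def dual.map_sel)
  show "r \<le> r'"
  proof (rule leading_columns_bound[OF Xs(1) mat_adjoint_carrier[OF Xs(1)] inv])
    show "r \<le> n" using svd by auto
    fix i j assume ij: "r' \<le> i" "i < n" "j < r"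
    then have j: "j < t" "j < n" using svd(1) by auto
    \<comment> \<open>Rows from \<open>r'\<close> on carry an infinitesimal \<open>d' i\<close>, so
      the standard part of the right-hand side vanishes, while \<open>d j\<close> has a nonzero
      standard part to cancel.\<close>
    have "std_part (X $$ (i,j)) * std_part (d j) = 0"
      using arg_cong[OF eq[OF ij(2) j(2)], of std_part] std_d'[OF ij(1)] by simp
    then show "Xs $$ (i,j) = 0"
      using std_pos[OF ij(3)] j ij(2) by (simp add: X_index d_def dual.map_sel)
  qed
  show "t \<le> t'"
  proof (rule leading_columns_bound[OF Xs(1) mat_adjoint_carrier[OF Xs(1)] inv])
    show "t \<le> n" using svd by auto
    fix i j assume ij: "t' \<le> i" "i < n" "j < t"
    then have j: "j < n" using svd(1) by auto
    \<comment> \<open>An infinitesimal \<open>\<mu> j\<close> is a zero divisor and cannot be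
      cancelled. A nonzero one still forces the standard part of \<open>X\<close> to vanish, through
      whichever part of \<open>\<mu> j\<close> is nonzero.\<close>
    have zero: "X $$ (i,j) * dual_complex_of_real (\<mu> j) = 0"
      using eq[OF ij(2) j] ij by (simp add: d_def d'_def)
    have "std_part (\<mu> j) \<noteq> 0 \<or> inf_part (\<mu> j) \<noteq> 0"
      using pos[OF ij(3)] by (cases "\<mu> j") (auto simp: zero_dual_def)
    then show "Xs $$ (i,j) = 0"
      using arg_cong[OF zero, of std_part] arg_cong[OF zero, of inf_part] ij(2) j
      by (auto simp: X_index dual.map_sel)
  qed
qed

text \<open>The inequalities applied in both directions make the counts unique, so the definite
  descriptions can be read off from any decomposition.\<close>

lemma dual_ranks_eq:
  assumes A: "A \<in> carrier_mat n n" and svd: "is_dual_svd A r t P \<mu> V"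
  shows "dual_ARank A = r" "dual_Rank A = t"
proof -
  have "r' = r" "t' = t" if "is_dual_svd A r' t' P' \<mu>' V'" for r' t' P' \<mu>' V'
    using dual_svd_ranks_le[OF A svd that] dual_svd_ranks_le[OF A that svd] by auto
  then show "dual_ARank A = r" "dual_Rank A = t"
    unfolding dual_ARank_def dual_Rank_def using svd by (intro the_equality; metis)+
qed

section \<open>Block matrices and the final form\<close>

text \<open>Fixing common carriers is essential, since one matrix can be cut into blocks at
  different places.\<close>

lemma four_block_mat_inject:
  assumes "four_block_mat A B C D = four_block_mat A' B' C' D'"
    and c: "A \<in> carrier_mat m k" "B \<in> carrier_mat m l" "C \<in> carrier_mat p k" "D \<in> carrier_mat p l"
    and c': "A' \<in> carrier_mat m k" "B' \<in> carrier_mat m l" "C' \<in> carrier_mat p k" "D' \<in> carrier_mat p l"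
  shows "A = A'" "B = B'" "C = C'" "D = D'"
proof -
  have eq: "four_block_mat A B C D $$ (i,j) = four_block_mat A' B' C' D' $$ (i,j)" for i j
    using assms(1) by simp
  show "A = A'"
  proof (rule eq_matI)
    fix i j assume "i < dim_row A'" "j < dim_col A'"
    then show "A $$ (i,j) = A' $$ (i,j)" using c c' eq[of i j] by auto
  qed (use c c' in auto)
  show "B = B'"
  proof (rule eq_matI)
    fix i j assume "i < dim_row B'" "j < dim_col B'"
    then show "B $$ (i,j) = B' $$ (i,j)" using c c' eq[of i "j + k"] by auto
  qed (use c c' in auto)
  show "C = C'"
  proof (rule eq_matI)
    fix i j assume "i < dim_row C'" "j < dim_col C'"
    then show "C $$ (i,j) = C' $$ (i,j)" using c c' eq[of "i + m" j] by auto
  qed (use c c' in auto)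
  show "D = D'"
  proof (rule eq_matI)
    fix i j assume "i < dim_row D'" "j < dim_col D'"
    then show "D $$ (i,j) = D' $$ (i,j)" using c c' eq[of "i + m" "j + k"] by auto
  qed (use c c' in auto)
qed

lemma four_block_mat_cases:
  assumes "A \<in> carrier_mat (m + p) (k + l)"
  obtains K L M N where "K \<in> carrier_mat m k" "L \<in> carrier_mat m l" "M \<in> carrier_mat p k"
    "N \<in> carrier_mat p l" "A = four_block_mat K L M N"
proof
  show "A = four_block_mat (mat m k (\<lambda>(i,j). A $$ (i,j))) (mat m l (\<lambda>(i,j). A $$ (i,j + k)))
    (mat p k (\<lambda>(i,j). A $$ (i + m,j))) (mat p l (\<lambda>(i,j). A $$ (i + m,j + k)))"
    by (rule eq_matI) (use assms in auto)
qed auto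

lemma mat_adjoint_four_block_mat:
  fixes A :: "complex mat"
  assumes "A \<in> carrier_mat m k" "B \<in> carrier_mat m l" "C \<in> carrier_mat p k" "D \<in> carrier_mat p l"
  shows "mat_adjoint (four_block_mat A B C D)
    = four_block_mat (mat_adjoint A) (mat_adjoint C) (mat_adjoint B) (mat_adjoint D)"
  by (rule eq_matI) (use assms in auto)

lemma mult_four_block_adjoint:
  fixes A A' :: "complex mat"
  assumes c: "A \<in> carrier_mat m k" "B \<in> carrier_mat m l" "C \<in> carrier_mat p k" "D \<in> carrier_mat p l"
    and c': "A' \<in> carrier_mat m k" "B' \<in> carrier_mat m l" "C' \<in> carrier_mat p k" "D' \<in> carrier_mat p l"
  shows "four_block_mat A B C D * mat_adjoint (four_block_mat A' B' C' D')
    = four_block_mat (A * mat_adjoint A' + B * mat_adjoint B') (A * mat_adjoint C' + B * mat_adjoint D')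
        (C * mat_adjoint A' + D * mat_adjoint B') (C * mat_adjoint C' + D * mat_adjoint D')"
  unfolding mat_adjoint_four_block_mat[OF c']
  by (rule mult_four_block_mat) (use c c' in auto)

lemma block_diag_mult_four_block_mat:
  assumes "E \<in> carrier_mat m m" "F \<in> carrier_mat p p"
    and c: "A \<in> carrier_mat m k" "B \<in> carrier_mat m l" "C \<in> carrier_mat p k" "D \<in> carrier_mat p l"
  shows "four_block_mat E (0\<^sub>m m p) (0\<^sub>m p m) F * four_block_mat A B C D
    = four_block_mat (E * A) (E * B) (F * C) (F * D)"
proof -
  have "four_block_mat E (0\<^sub>m m p) (0\<^sub>m p m) F * four_block_mat A B C D
    = four_block_mat (E * A + 0\<^sub>m m p * C) (E * B + 0\<^sub>m m p * D) (0\<^sub>m p m * A + F * C) (0\<^sub>m p m * B + F * D)"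
    by (rule mult_four_block_mat) (use assms in auto)
  moreover have "E * A \<in> carrier_mat m k" "E * B \<in> carrier_mat m l"
    "F * C \<in> carrier_mat p k" "F * D \<in> carrier_mat p l" using assms by auto
  ultimately show ?thesis using c by simp
qed

theorem theorem3p3:
  fixes A :: "complex dual mat" and n r t :: nat
  assumes "A \<in> carrier_mat n n"
    and "r = dual_ARank A"
    and "t = dual_Rank A"
  shows "\<exists>U (\<mu> :: nat \<Rightarrow> real dual) \<Sigma>1 \<Sigma>2 \<Sigma>1s \<Sigma>1d \<Sigma>2d K1 K2 L1 L2 M1 M2 N1 N2.
    U \<in> dual_unitary n \<and>
    \<Sigma>1s \<in> carrier_mat r r \<and> \<Sigma>1d \<in> carrier_mat r r \<and> \<Sigma>2d \<in> carrier_mat (n - r) (n - r) \<and>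
    K1 \<in> carrier_mat r r \<and> K2 \<in> carrier_mat r r \<and>
    L1 \<in> carrier_mat r (n - r) \<and> L2 \<in> carrier_mat r (n - r) \<and>
    M1 \<in> carrier_mat (n - r) r \<and> M2 \<in> carrier_mat (n - r) r \<and>
    N1 \<in> carrier_mat (n - r) (n - r) \<and> N2 \<in> carrier_mat (n - r) (n - r) \<and>
    (\<forall>i<r. appreciable (\<mu> i) \<and> 0 < \<mu> i) \<and>
    (\<forall>i. r \<le> i \<and> i < t \<longrightarrow> infinitesimal (\<mu> i) \<and> 0 < \<mu> i) \<and>
    \<Sigma>1 = mat_diag r (\<lambda>i. dual_complex_of_real (\<mu> i)) \<and>
    \<Sigma>2 = mat_diag (n - r) (\<lambda>i. if r + i < t then dual_complex_of_real (\<mu> (r + i)) else 0) \<and>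
    \<Sigma>1 = dual_mat \<Sigma>1s \<Sigma>1d \<and>
    \<Sigma>2 = dual_eps \<cdot>\<^sub>m const_mat \<Sigma>2d \<and>
    A = U *
        (four_block_mat (\<Sigma>1 * const_mat K1) (\<Sigma>1 * const_mat L1)
                        (\<Sigma>2 * const_mat M1) (\<Sigma>2 * const_mat N1)
         + dual_eps \<cdot>\<^sub>m
           four_block_mat (\<Sigma>1 * const_mat K2) (\<Sigma>1 * const_mat L2)
                          (\<Sigma>2 * const_mat M2) (\<Sigma>2 * const_mat N2))
        * dual_adjoint U \<and>
    A = U *
        dual_mat
          (four_block_mat (\<Sigma>1s * K1) (\<Sigma>1s * L1) (0\<^sub>m (n - r) r) (0\<^sub>m (n - r) (n - r)))
          (four_block_mat (\<Sigma>1d * K1 + \<Sigma>1s * K2) (\<Sigma>1d * L1 + \<Sigma>1s * L2)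
                          (\<Sigma>2d * M1) (\<Sigma>2d * N1))
        * dual_adjoint U \<and>
    K1 * mat_adjoint K1 + L1 * mat_adjoint L1 = 1\<^sub>m r \<and>
    K1 * mat_adjoint K2 + K2 * mat_adjoint K1 + L1 * mat_adjoint L2 + L2 * mat_adjoint L1
      = 0\<^sub>m r r \<and>
    M1 * mat_adjoint M1 + N1 * mat_adjoint N1 = 1\<^sub>m (n - r) \<and>
    K1 * mat_adjoint M1 + L1 * mat_adjoint N1 = 0\<^sub>m r (n - r)"
proof -
  note A = assms(1)
  obtain r' t' P \<mu> V where svd: "is_dual_svd A r' t' P \<mu> V"
    using dual_svd_exists[OF A] by blast
  have "r' = r" "t' = t" using dual_ranks_eq[OF A svd] assms(2,3) by auto
  note svd = svd[unfolded is_dual_svd_square_iff[OF A] this]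
  define S where "S = mat_diag n (\<lambda>i. if i < t then dual_complex_of_real (\<mu> i) else 0)"
  have rt: "r \<le> t" "t \<le> n" and P: "P \<in> dual_unitary n" and V: "V \<in> dual_unitary n"
    and app: "\<And>i. i < r \<Longrightarrow> appreciable (\<mu> i) \<and> 0 < \<mu> i"
    and inf: "\<And>i. r \<le> i \<Longrightarrow> i < t \<Longrightarrow> infinitesimal (\<mu> i) \<and> 0 < \<mu> i"
    and A_eq: "A = P * S * dual_adjoint V"
    using svd by (auto simp: S_def)
  have S: "S \<in> carrier_mat n n" by (simp add: S_def)
  note Pc = dual_unitaryD[OF P] and Vc = dual_unitaryD[OF V]
  define W where "W = dual_adjoint V * P"
  have W: "W \<in> dual_unitary n" unfolding W_def by (intro dual_unitary_mult dual_unitary_adjoint P V)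
  have A_conj: "A = P * (S * W) * dual_adjoint P"
    unfolding A_eq W_def using Pc Vc(1) S
    by (simp add: assoc_mult_mat[of _ n n _ n _ n] mult_carrier_mat[of _ n n _ n]
        right_mult_one_mat[of _ n n])
  \<comment> \<open>With \<open>n = r + q\<close> the block sizes add up without truncated
    subtraction.\<close>
  define q where "q = n - r"
  have n: "n = r + q" using rt by (simp add: q_def)
  obtain Ws Wd where Wsd: "Ws \<in> carrier_mat n n" "Wd \<in> carrier_mat n n" "W = dual_mat Ws Wd"
    using dual_mat_cases[OF dual_unitaryD(1)[OF W]] .
  obtain K1 L1 M1 N1 where Ws: "K1 \<in> carrier_mat r r" "L1 \<in> carrier_mat r q" "M1 \<in> carrier_mat q r"
    "N1 \<in> carrier_mat q q" "Ws = four_block_mat K1 L1 M1 N1"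
    using four_block_mat_cases Wsd(1) unfolding n .
  obtain K2 L2 M2 N2 where Wd: "K2 \<in> carrier_mat r r" "L2 \<in> carrier_mat r q" "M2 \<in> carrier_mat q r"
    "N2 \<in> carrier_mat q q" "Wd = four_block_mat K2 L2 M2 N2"
    using four_block_mat_cases Wsd(2) unfolding n .
  define \<Sigma>1 where "\<Sigma>1 = mat_diag r (\<lambda>i. dual_complex_of_real (\<mu> i))"
  define \<Sigma>2 where "\<Sigma>2 = mat_diag q (\<lambda>i. if r + i < t then dual_complex_of_real (\<mu> (r + i)) else 0)"
  define \<Sigma>1s where "\<Sigma>1s = map_mat std_part \<Sigma>1"
  define \<Sigma>1d where "\<Sigma>1d = map_mat inf_part \<Sigma>1"
  define \<Sigma>2d where "\<Sigma>2d = map_mat inf_part \<Sigma>2"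
  have \<Sigma>: "\<Sigma>1 \<in> carrier_mat r r" "\<Sigma>2 \<in> carrier_mat q q" "\<Sigma>1s \<in> carrier_mat r r"
    "\<Sigma>1d \<in> carrier_mat r r" "\<Sigma>2d \<in> carrier_mat q q"
    by (auto simp: \<Sigma>1_def \<Sigma>2_def \<Sigma>1s_def \<Sigma>1d_def \<Sigma>2d_def)
  have \<Sigma>1_eq: "\<Sigma>1 = dual_mat \<Sigma>1s \<Sigma>1d" unfolding \<Sigma>1s_def \<Sigma>1d_def dual_mat_parts ..
  \<comment> \<open>The diagonal entries are infinitesimal below \<open>t\<close> and zero from
    there on.\<close>
  have \<Sigma>2_std: "map_mat std_part \<Sigma>2 = 0\<^sub>m q q"
    by (rule eq_matI) (use inf in \<open>auto simp: \<Sigma>2_def mat_diag_def infinitesimal_def dual.map_sel\<close>)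
  have \<Sigma>2_dual: "\<Sigma>2 = dual_mat (0\<^sub>m q q) \<Sigma>2d"
    using dual_mat_parts[of \<Sigma>2] unfolding \<Sigma>2_std \<Sigma>2d_def by simp
  have \<Sigma>2_eq: "\<Sigma>2 = dual_eps \<cdot>\<^sub>m const_mat \<Sigma>2d"
    unfolding \<Sigma>2_dual by (rule eq_matI) (use \<Sigma>(5) in \<open>auto intro: dual.expand\<close>)
  \<comment> \<open>As \<open>r \<le> t\<close>, the cutoff at \<open>t\<close> falls into the
    second block.\<close>
  have S_eq: "S = four_block_mat \<Sigma>1 (0\<^sub>m r q) (0\<^sub>m q r) \<Sigma>2"
    unfolding S_def \<Sigma>1_def \<Sigma>2_def n by (rule eq_matI) (use rt in \<open>auto simp: mat_diag_def\<close>)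
  have const_blocks: "S * const_mat (four_block_mat K L M N)
      = four_block_mat (\<Sigma>1 * const_mat K) (\<Sigma>1 * const_mat L) (\<Sigma>2 * const_mat M) (\<Sigma>2 * const_mat N)"
    if c: "K \<in> carrier_mat r r" "L \<in> carrier_mat r q" "M \<in> carrier_mat q r" "N \<in> carrier_mat q q"
    for K L M N
    unfolding S_eq map_four_block_mat[OF c]
    by (rule block_diag_mult_four_block_mat) (use \<Sigma> c in auto)
  have first: "S * W = four_block_mat (\<Sigma>1 * const_mat K1) (\<Sigma>1 * const_mat L1)
        (\<Sigma>2 * const_mat M1) (\<Sigma>2 * const_mat N1)
      + dual_eps \<cdot>\<^sub>m four_block_mat (\<Sigma>1 * const_mat K2) (\<Sigma>1 * const_mat L2)
        (\<Sigma>2 * const_mat M2) (\<Sigma>2 * const_mat N2)"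
  proof -
    have "S * W = S * const_mat Ws + S * (dual_eps \<cdot>\<^sub>m const_mat Wd)"
      unfolding Wsd(3) by (rule mult_add_distrib_mat) (use S Wsd in auto)
    also have "S * (dual_eps \<cdot>\<^sub>m const_mat Wd) = dual_eps \<cdot>\<^sub>m (S * const_mat Wd)"
      by (rule mult_smult_distrib) (use S Wsd in auto)
    finally show ?thesis
      unfolding Ws(5) Wd(5) const_blocks[OF Ws(1-4)] const_blocks[OF Wd(1-4)] .
  qed
  define Ss where "Ss = four_block_mat \<Sigma>1s (0\<^sub>m r q) (0\<^sub>m q r) (0\<^sub>m q q)"
  define Sd where "Sd = four_block_mat \<Sigma>1d (0\<^sub>m r q) (0\<^sub>m q r) \<Sigma>2d"
  have Ssd: "Ss \<in> carrier_mat n n" "Sd \<in> carrier_mat n n"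
    using \<Sigma> by (auto simp: Ss_def Sd_def n)
  have S_dual: "S = dual_mat Ss Sd"
    unfolding S_eq by (rule eq_matI)
      (use \<Sigma> in \<open>auto simp: Ss_def Sd_def \<Sigma>1_eq \<Sigma>2_dual intro: dual.expand\<close>)
  \<comment> \<open>The infinitesimal part of the product is \<open>Ss * Wd + Sd * Ws\<close>. The
    zero bottom rows of \<open>Ss\<close> annihilate \<open>M2\<close> and \<open>N2\<close>,
    leaving only \<open>M1\<close> and \<open>N1\<close> below.\<close>
  have second: "S * W = dual_mat
      (four_block_mat (\<Sigma>1s * K1) (\<Sigma>1s * L1) (0\<^sub>m q r) (0\<^sub>m q q))
      (four_block_mat (\<Sigma>1d * K1 + \<Sigma>1s * K2) (\<Sigma>1d * L1 + \<Sigma>1s * L2) (\<Sigma>2d * M1) (\<Sigma>2d * N1))"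
  proof -
    have "Ss * Ws = four_block_mat (\<Sigma>1s * K1) (\<Sigma>1s * L1) (0\<^sub>m q q * M1) (0\<^sub>m q q * N1)"
      unfolding Ss_def Ws(5) by (rule block_diag_mult_four_block_mat) (use \<Sigma> Ws(1-4) in \<open>auto intro: mult_carrier_mat\<close>)
    then have 1: "Ss * Ws = four_block_mat (\<Sigma>1s * K1) (\<Sigma>1s * L1) (0\<^sub>m q r) (0\<^sub>m q q)"
      using Ws by simp
    have "Ss * Wd = four_block_mat (\<Sigma>1s * K2) (\<Sigma>1s * L2) (0\<^sub>m q q * M2) (0\<^sub>m q q * N2)"
      unfolding Ss_def Wd(5) by (rule block_diag_mult_four_block_mat) (use \<Sigma> Wd(1-4) in \<open>auto intro: mult_carrier_mat\<close>)
    then have 2: "Ss * Wd = four_block_mat (\<Sigma>1s * K2) (\<Sigma>1s * L2) (0\<^sub>m q r) (0\<^sub>m q q)"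
      using Wd by simp
    have 3: "Sd * Ws = four_block_mat (\<Sigma>1d * K1) (\<Sigma>1d * L1) (\<Sigma>2d * M1) (\<Sigma>2d * N1)"
      unfolding Sd_def Ws(5) by (rule block_diag_mult_four_block_mat) (use \<Sigma> Ws(1-4) in \<open>auto intro: mult_carrier_mat\<close>)
    have "S * W = dual_mat (Ss * Ws) (Ss * Wd + Sd * Ws)"
      unfolding S_dual Wsd(3) by (rule dual_mat_mult[OF Ssd Wsd(1,2)])
    also have "Ss * Wd + Sd * Ws = Sd * Ws + Ss * Wd"
      by (rule comm_add_mat[of _ n n]) (use Ssd Wsd in auto)
    also have "\<dots> = four_block_mat (\<Sigma>1d * K1 + \<Sigma>1s * K2) (\<Sigma>1d * L1 + \<Sigma>1s * L2)
        (\<Sigma>2d * M1 + 0\<^sub>m q r) (\<Sigma>2d * N1 + 0\<^sub>m q q)"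
      unfolding 2 3 by (rule add_four_block_mat) (use \<Sigma> Ws(1-4) Wd(1-4) in \<open>auto intro: mult_carrier_mat\<close>)
    also have "\<Sigma>2d * M1 + 0\<^sub>m q r = \<Sigma>2d * M1"
      by (rule right_add_zero_mat) (use \<Sigma> Ws(1-4) in \<open>auto intro: mult_carrier_mat\<close>)
    also have "\<Sigma>2d * N1 + 0\<^sub>m q q = \<Sigma>2d * N1"
      by (rule right_add_zero_mat) (use \<Sigma> Ws(1-4) in \<open>auto intro: mult_carrier_mat\<close>)
    finally show ?thesis unfolding 1 .
  qed
  note unitary_parts = dual_unitary_parts[OF W[unfolded Wsd(3)] Wsd(1,2)]
  have "four_block_mat (K1 * mat_adjoint K1 + L1 * mat_adjoint L1) (K1 * mat_adjoint M1 + L1 * mat_adjoint N1)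
      (M1 * mat_adjoint K1 + N1 * mat_adjoint L1) (M1 * mat_adjoint M1 + N1 * mat_adjoint N1)
    = four_block_mat (1\<^sub>m r) (0\<^sub>m r q) (0\<^sub>m q r) (1\<^sub>m q)"
    using unitary_parts(1)
    unfolding Ws(5) mult_four_block_adjoint[OF Ws(1-4) Ws(1-4)] n four_block_one_mat .
  note std = four_block_mat_inject[OF this, of r r q q]
  have "four_block_mat (K1 * mat_adjoint K2 + L1 * mat_adjoint L2 + (K2 * mat_adjoint K1 + L2 * mat_adjoint L1))
      (K1 * mat_adjoint M2 + L1 * mat_adjoint N2 + (K2 * mat_adjoint M1 + L2 * mat_adjoint N1))
      (M1 * mat_adjoint K2 + N1 * mat_adjoint L2 + (M2 * mat_adjoint K1 + N2 * mat_adjoint L1))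
      (M1 * mat_adjoint M2 + N1 * mat_adjoint N2 + (M2 * mat_adjoint M1 + N2 * mat_adjoint N1))
    = Ws * mat_adjoint Wd + Wd * mat_adjoint Ws"
    unfolding Ws(5) Wd(5) mult_four_block_adjoint[OF Ws(1-4) Wd(1-4)]
      mult_four_block_adjoint[OF Wd(1-4) Ws(1-4)]
    by (rule add_four_block_mat[symmetric]) (use Ws(1-4) Wd(1-4) in auto)
  also have "\<dots> = four_block_mat (0\<^sub>m r r) (0\<^sub>m r q) (0\<^sub>m q r) (0\<^sub>m q q)"
    unfolding unitary_parts(3) by (simp add: n)
  \<comment> \<open>The upper left block of the first-order unitarity equation yields the mixed
    relation.\<close>
  finally have inf_eq: "K1 * mat_adjoint K2 + L1 * mat_adjoint L2
      + (K2 * mat_adjoint K1 + L2 * mat_adjoint L1) = 0\<^sub>m r r"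
    by (rule four_block_mat_inject(1)[of _ _ _ _ _ _ _ _ r r q q]) (use Ws(1-4) Wd(1-4) in auto)
  have "K1 * mat_adjoint K2 \<in> carrier_mat r r" "L1 * mat_adjoint L2 \<in> carrier_mat r r"
    "K2 * mat_adjoint K1 \<in> carrier_mat r r" "L2 * mat_adjoint L1 \<in> carrier_mat r r"
    using Ws(1-4) Wd(1-4) by auto
  moreover have "X + Z + Y + T = X + Y + (Z + T)"
    if "X \<in> carrier_mat r r" "Y \<in> carrier_mat r r" "Z \<in> carrier_mat r r" "T \<in> carrier_mat r r"
    for X Y Z T :: "complex mat"
    by (rule eq_matI) (use that in auto)
  ultimately have "K1 * mat_adjoint K2 + K2 * mat_adjoint K1 + L1 * mat_adjoint L2 + L2 * mat_adjoint L1
      = 0\<^sub>m r r" using inf_eq by simp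
  moreover have "K1 * mat_adjoint K1 + L1 * mat_adjoint L1 = 1\<^sub>m r"
    "M1 * mat_adjoint M1 + N1 * mat_adjoint N1 = 1\<^sub>m q"
    "K1 * mat_adjoint M1 + L1 * mat_adjoint N1 = 0\<^sub>m r q"
    using Ws by (intro std; force)+
  moreover have "\<forall>i<r. appreciable (\<mu> i) \<and> 0 < \<mu> i"
    "\<forall>i. r \<le> i \<and> i < t \<longrightarrow> infinitesimal (\<mu> i) \<and> 0 < \<mu> i"
    using app inf by blast+
  ultimately show ?thesis
    unfolding q_def[symmetric]
    using P \<Sigma>(3-5) Ws(1-4) Wd(1-4) \<Sigma>1_def \<Sigma>2_def \<Sigma>1_eq \<Sigma>2_eq
      A_conj[unfolded first] A_conj[unfolded second]
    by - (rule exI[of _ P], rule exI[of _ \<mu>], rule exI[of _ \<Sigma>1], rule exI[of _ \<Sigma>2],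
        rule exI[of _ \<Sigma>1s], rule exI[of _ \<Sigma>1d], rule exI[of _ \<Sigma>2d], rule exI[of _ K1],
        rule exI[of _ K2], rule exI[of _ L1], rule exI[of _ L2], rule exI[of _ M1],
        rule exI[of _ M2], rule exI[of _ N1], rule exI[of _ N2], intro conjI; assumption)
qed

end
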